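(* Let $n\ge 1$ and $0\le e\le\binom{n}{2}$. For every simple graph $G$ with $n$ vertices and $e$ edges, and for every integer $k\ge 0$, $$m(G) \geq \min\{ m(\mathcal{L}(n,e)), m(\mathcal{C}(n,e))\}$$ and $$m_k(G) \geq \min\{ m_k(\mathcal{L}(n,e)), m_k(\mathcal{C}(n,e))\}.$$
   Context: A matching in a graph is a set of pairwise non-incident edges (the empty set is a matching). $m(G)$ denotes the number of matchings of $G$ and $m_k(G)$ the number of matchings of $G$ with exactly $k$ edges. The lexicographic order on finite subsets of $\mathbb{N}$ is $A<_L B$ iff $\min(A\Delta B)\in A$; the colexicographic order is $A<_C B$ iff $\max(A\Delta B)\in B$. Restricting these to $2$-subsets of $[n]=\{1,\dots,n\}$ orders the edges of $K_n$. The lex graph $\mathcal{L}(n,e)$ has vertex set $[n]$ and edge set the first $e$ edges of $K_n$ in lex order (i.e. $\{1,2\},\{1,3\},\dots,\{1,n\},\{2,3\},\dots$); the colex graph $\mathcal{C}(n,e)$ has vertex set $[n]$ and edge set the first $e$ edges of $K_n$ in colex order (i.e. $\{1,2\},\{1,3\},\{2,3\},\{1,4\},\{2,4\},\{3,4\},\{1,5\},\dots$). *)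

theory Defs
  imports Complex_Main "HOL-Library.Ramsey"
begin

type_synonym 'a graph = "'a set \<times> 'a set set"

abbreviation verts :: "'a graph \<Rightarrow> 'a set" where
  "verts G \<equiv> fst G"

abbreviation edges :: "'a graph \<Rightarrow> 'a set set" where
  "edges G \<equiv> snd G"

definition simple_graph :: "'a graph \<Rightarrow> bool" where
  "simple_graph G \<longleftrightarrow> finite (verts G) \<and> edges G \<subseteq> nsets (verts G) 2"

definition matching :: "'a graph \<Rightarrow> 'a set set \<Rightarrow> bool" where
  "matching G M \<longleftrightarrow> M \<subseteq> edges G \<and> pairwise disjnt M"

definition num_matchings :: "'a graph \<Rightarrow> nat" where
  "num_matchings G = card {M. matching G M}"

definition num_matchings_of_size :: "nat \<Rightarrow> 'a graph \<Rightarrow> nat" where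
  "num_matchings_of_size k G = card {M. matching G M \<and> card M = k}"

(* The conjunct A \<noteq> B excludes the unspecified values Min {} and Max {}. *)

definition lex_less :: "nat set \<Rightarrow> nat set \<Rightarrow> bool" where
  "lex_less A B \<longleftrightarrow> A \<noteq> B \<and> Min (sym_diff A B) \<in> A"

definition colex_less :: "nat set \<Rightarrow> nat set \<Rightarrow> bool" where
  "colex_less A B \<longleftrightarrow> A \<noteq> B \<and> Max (sym_diff A B) \<in> B"

(* The first k elements of a finite set S under a strict linear order R: those with
   fewer than k predecessors in S. *)

definition first_elems :: "('b \<Rightarrow> 'b \<Rightarrow> bool) \<Rightarrow> 'b set \<Rightarrow> nat \<Rightarrow> 'b set" where
  "first_elems R S k = {x \<in> S. card {y \<in> S. R y x} < k}"

definition lex_graph :: "nat \<Rightarrow> nat \<Rightarrow> nat graph" where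
  "lex_graph n e = ({1..n}, first_elems lex_less (nsets {1..n} 2) e)"

definition colex_graph :: "nat \<Rightarrow> nat \<Rightarrow> nat graph" where
  "colex_graph n e = ({1..n}, first_elems colex_less (nsets {1..n} 2) e)"

end

theory Submission
  imports Defs "HOL-Computational_Algebra.Polynomial" "HOL-Combinatorics.Transposition"
begin

text \<open>
  Encode a graph on \<open>n\<close> vertices by the polynomial \<open>\<Sum>M. y^(n - 2|M|)\<close> over its matchings.
  Adding an isolated vertex is then the operator \<open>I p = y p\<close>, adding a dominating vertex is
  \<open>D p = y p + p'\<close>, and \<open>D I = I D + 1\<close>. Both operators preserve the coefficientwise order.

  Moving to a fixed vertex \<open>x\<close> all edges of other vertices that can be moved there never increases the
  number of matchings of any size; when no more edges can be moved, \<open>x\<close> is dominating or some vertex is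
  isolated. By induction the remaining graph may be replaced by a lex or a colex graph (which of the
  two does not depend on the size of the matchings), and it remains to compare \<open>I\<close> of a lex graph and
  \<open>D\<close> of a colex graph with the lex and colex graphs on one more vertex. The lex polynomial is
  \<open>D^q (y^N + s y^(N-2))\<close>, the colex polynomial is \<open>y^j (y D^d 1 + t D^(d-1) 1)\<close>, and the commutation rule
  turns every comparison into an identity whose error term is a product of two nonnegative integers
  and a polynomial with nonnegative coefficients.
\<close>

section \<open>Adding an isolated or a dominating vertex\<close>

definition iso_op :: "int poly \<Rightarrow> int poly" where
  "iso_op p = pCons 0 p"

definition dom_op :: "int poly \<Rightarrow> int poly" where
  "dom_op p = pCons 0 p + pderiv p"

definition coeff_le :: "int poly \<Rightarrow> int poly \<Rightarrow> bool" (infix "\<preceq>" 50) where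
  "p \<preceq> q \<longleftrightarrow> (\<forall>i. coeff p i \<le> coeff q i)"

lemma coeff_le_refl [simp]: "p \<preceq> p"
  by (simp add: coeff_le_def)

lemma coeff_le_trans [trans]: "p \<preceq> q \<Longrightarrow> q \<preceq> r \<Longrightarrow> p \<preceq> r"
  unfolding coeff_le_def by (meson order_trans)

lemma coeff_of_nat_mult [simp]: "coeff (of_nat n * p) i = int n * coeff (p :: int poly) i"
  by (simp add: of_nat_poly)

lemma coeff_numeral_mult [simp]: "coeff (numeral n * p) i = numeral n * coeff (p :: int poly) i"
  using coeff_of_nat_mult[of "numeral n" p i] by simp

text \<open>The form in which the inequalities below are discharged: the gap is exhibited as a
  natural multiple of a nonnegative polynomial.\<close>

lemma coeff_le_add_of_nat: "0 \<preceq> p \<Longrightarrow> q = r + of_nat n * p \<Longrightarrow> r \<preceq> q"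
  by (simp add: coeff_le_def)

text \<open>Needed when edges are deleted: bounds are stated with the deletion term moved to the
  left, whereas the linking identity is easier with subtraction.\<close>

lemma coeff_le_diff_trans:
  assumes "x + p \<preceq> q" "q - p \<preceq> r - s"
  shows "x + s \<preceq> r"
  unfolding coeff_le_def
proof
  fix i
  show "coeff (x + s) i \<le> coeff r i"
    using spec[OF assms(1)[unfolded coeff_le_def], of i] spec[OF assms(2)[unfolded coeff_le_def], of i]
    by simp
qed

lemma iso_op_mono: "p \<preceq> q \<Longrightarrow> iso_op p \<preceq> iso_op q"
  by (simp add: coeff_le_def iso_op_def coeff_pCons split: nat.split)

lemma dom_op_mono: "p \<preceq> q \<Longrightarrow> dom_op p \<preceq> dom_op q"
  by (auto simp: coeff_le_def dom_op_def coeff_pCons coeff_pderiv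
      intro!: add_mono mult_left_mono split: nat.split)

lemma iso_op_add: "iso_op (p + q) = iso_op p + iso_op q"
  by (simp add: iso_op_def)

lemma dom_op_add: "dom_op (p + q) = dom_op p + dom_op q"
  by (simp add: dom_op_def pderiv_add)

lemma iso_op_of_nat_mult: "iso_op (of_nat n * p) = of_nat n * iso_op p"
  by (simp add: iso_op_def)

lemma dom_op_of_nat_mult: "dom_op (of_nat n * p) = of_nat n * dom_op p"
  by (simp add: dom_op_def pderiv_mult algebra_simps)

lemma dom_iso_op: "dom_op (iso_op p) = iso_op (dom_op p) + p"
  by (simp add: dom_op_def iso_op_def pderiv_pCons)

lemmas op_linear = iso_op_add dom_op_add iso_op_of_nat_mult dom_op_of_nat_mult

lemma dom_op_pow_add: "(dom_op ^^ q) (p + r) = (dom_op ^^ q) p + (dom_op ^^ q) r"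
  by (induction q) (simp_all add: op_linear)

lemma dom_op_pow_of_nat_mult: "(dom_op ^^ q) (of_nat n * p) = of_nat n * (dom_op ^^ q) p"
  by (induction q) (simp_all add: op_linear)

lemma iso_op_pow_add: "(iso_op ^^ q) (p + r) = (iso_op ^^ q) p + (iso_op ^^ q) r"
  by (induction q) (simp_all add: op_linear)

lemma iso_op_pow_of_nat_mult: "(iso_op ^^ q) (of_nat n * p) = of_nat n * (iso_op ^^ q) p"
  by (induction q) (simp_all add: op_linear)

text \<open>Each of the \<open>Suc q\<close> copies of \<open>dom_op\<close> that passes
  \<open>iso_op\<close> leaves one term with that copy removed. The successor keeps the exponent
  \<open>q\<close> of the error term free of truncation; the next lemma is the mirror image.\<close>

lemma dom_pow_iso_op:
  "(dom_op ^^ Suc q) (iso_op p) = iso_op ((dom_op ^^ Suc q) p) + of_nat (Suc q) * (dom_op ^^ q) p"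
  by (induction q) (simp_all add: dom_iso_op op_linear algebra_simps)

lemma dom_iso_pow_op:
  "dom_op ((iso_op ^^ Suc a) p) = (iso_op ^^ Suc a) (dom_op p) + of_nat (Suc a) * (iso_op ^^ a) p"
  by (induction a) (simp_all add: dom_iso_op op_linear algebra_simps)

text \<open>The matching polynomial of \<open>q\<close> mutually adjacent vertices, all joined to
  \<open>N\<close> independent vertices (a complete split graph).\<close>

definition dom_indep :: "nat \<Rightarrow> nat \<Rightarrow> int poly" where
  "dom_indep q N = (dom_op ^^ q) (monom 1 N)"

text \<open>The matching polynomial of a clique on \<open>d\<close> vertices together with
  \<open>a\<close> isolated vertices.\<close>

definition iso_clique :: "nat \<Rightarrow> nat \<Rightarrow> int poly" where
  "iso_clique a d = (iso_op ^^ a) ((dom_op ^^ d) 1)"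

section \<open>Recurrences for complete split graphs and for cliques with isolated vertices\<close>

lemma iso_op_monom: "iso_op (monom 1 N) = monom 1 (Suc N)"
  by (simp add: iso_op_def monom_Suc)

lemma dom_op_one: "dom_op 1 = monom 1 1"
  by (simp add: dom_op_def monom_Suc pderiv_1)

lemma dom_op_monom_Suc: "dom_op (monom 1 (Suc N)) = monom 1 (Suc (Suc N)) + of_nat (Suc N) * monom 1 N"
proof -
  have "of_nat (Suc N) * monom 1 N = monom (int (Suc N)) N"
    by (intro poly_eqI) (simp add: coeff_of_nat_mult del: of_nat_Suc)
  moreover have "pCons 0 (monom 1 (Suc N)) = monom (1 :: int) (Suc (Suc N))"
    by (rule monom_Suc [symmetric])
  ultimately show ?thesis
    by (simp add: dom_op_def pderiv_monom del: of_nat_Suc)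
qed

lemma nonneg_dom_indep [simp]: "0 \<preceq> dom_indep q N"
proof (induction q)
  case 0
  then show ?case by (simp add: dom_indep_def coeff_le_def)
next
  case (Suc q)
  have "dom_op 0 = 0" by (simp add: dom_op_def)
  with dom_op_mono[OF Suc] show ?case by (simp add: dom_indep_def)
qed

lemma iso_clique_0: "iso_clique a 0 = monom 1 a"
  by (induction a) (simp_all add: iso_clique_def iso_op_monom)

lemma dom_op_clique: "(dom_op ^^ d) 1 = dom_indep d 0"
  by (simp add: dom_indep_def)

lemma nonneg_iso_clique [simp]: "0 \<preceq> iso_clique a d"
proof (induction a)
  case 0
  then show ?case by (simp add: iso_clique_def dom_op_clique)
next
  case (Suc a)
  have "iso_op 0 = 0" by (simp add: iso_op_def)
  with iso_op_mono[OF Suc] show ?case by (simp add: iso_clique_def)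
qed

lemma dom_op_dom_indep: "dom_op (dom_indep q N) = dom_indep (Suc q) N"
  by (simp add: dom_indep_def)

lemma dom_indep_Suc_0: "dom_indep (Suc q) 0 = dom_indep q 1"
  by (simp add: dom_indep_def funpow_Suc_right dom_op_one del: funpow.simps)

text \<open>Expands the innermost \<open>dom_op\<close>: one clique vertex has no edge to the
  independent part in the matching and counts as independent, or it is matched to one of the
  \<open>Suc N\<close> independent vertices.\<close>

lemma dom_indep_Suc_Suc:
  "dom_indep (Suc q) (Suc N) = dom_indep q (Suc (Suc N)) + of_nat (Suc N) * dom_indep q N"
  by (simp add: dom_indep_def funpow_Suc_right dom_op_monom_Suc dom_op_pow_add dom_op_pow_of_nat_mult
      del: funpow.simps of_nat_Suc)

text \<open>Here one independent vertex is singled out: it is unmatched, or matched to one of the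
  \<open>Suc q\<close> clique vertices.\<close>

lemma iso_op_dom_indep_Suc:
  "dom_indep (Suc q) (Suc N) = iso_op (dom_indep (Suc q) N) + of_nat (Suc q) * dom_indep q N"
  using dom_pow_iso_op[of q "monom 1 N"] by (simp add: dom_indep_def iso_op_monom)

lemma iso_op_iso_clique: "iso_op (iso_clique a d) = iso_clique (Suc a) d"
  by (simp add: iso_clique_def)

lemma iso_clique_1: "iso_clique a (Suc 0) = iso_clique (Suc a) 0"
  by (induction a) (simp_all add: iso_clique_def dom_op_one iso_op_def monom_Suc)

text \<open>The three-term recurrence of Hermite type: a fixed clique vertex is unmatched or matched
  to one of the \<open>Suc d\<close> others.\<close>

lemma iso_clique_Suc_Suc:
  "iso_clique a (Suc (Suc d)) = iso_clique (Suc a) (Suc d) + of_nat (Suc d) * iso_clique a d"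
proof -
  have "(dom_op ^^ Suc (Suc d)) 1 = (dom_op ^^ Suc d) (iso_op 1)"
    by (simp add: funpow_Suc_right dom_op_one iso_op_def monom_Suc del: funpow.simps)
  also have "\<dots> = iso_op ((dom_op ^^ Suc d) 1) + of_nat (Suc d) * (dom_op ^^ d) 1"
    by (rule dom_pow_iso_op)
  finally show ?thesis
    unfolding iso_clique_def
    by (simp add: iso_op_pow_add iso_op_pow_of_nat_mult funpow_Suc_right del: funpow.simps of_nat_Suc)
qed

lemma dom_op_iso_clique_0: "dom_op (iso_clique 0 d) = iso_clique 0 (Suc d)"
  by (simp add: iso_clique_def)

lemma dom_op_iso_clique_Suc:
  "dom_op (iso_clique (Suc a) d) = iso_clique (Suc a) (Suc d) + of_nat (Suc a) * iso_clique a d"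
  using dom_iso_pow_op[of a "(dom_op ^^ d) 1"] by (simp add: iso_clique_def)

section \<open>Lex and colex polynomials\<close>

text \<open>With at least \<open>n\<close> edges on \<open>Suc n\<close> vertices, the first vertex
  of the lex graph is dominating; with fewer edges the graph is a star plus isolated
  vertices.\<close>

fun lex_poly :: "nat \<Rightarrow> nat \<Rightarrow> int poly" where
  "lex_poly 0 e = 1"
| "lex_poly (Suc n) e = (if e \<ge> n then dom_op (lex_poly n (e - n))
     else monom 1 (Suc n) + of_nat e * monom 1 (n - 1))"

text \<open>If the edges fit on \<open>n\<close> vertices, the last vertex is isolated. Otherwise
  the first \<open>n\<close> vertices form a clique and the last vertex is adjacent to the first
  one, which is therefore dominating.\<close>

fun colex_poly :: "nat \<Rightarrow> nat \<Rightarrow> int poly" where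
  "colex_poly 0 e = 1"
| "colex_poly (Suc n) e = (if e \<le> n choose 2 then iso_op (colex_poly n e)
     else dom_op (colex_poly n (e - n)))"

lemma Suc_choose_2: "Suc n choose 2 = (n choose 2) + n"
  by (simp add: numeral_2_eq_2)

lemma zero_choose_2 [simp]: "0 choose 2 = (0 :: nat)"
  by (simp add: numeral_2_eq_2)

lemma choose_2_mono: "m \<le> n \<Longrightarrow> m choose 2 \<le> n choose 2"
  by (rule lift_Suc_mono_le[of "\<lambda>n. n choose 2"]) (simp_all add: Suc_choose_2)

lemma lex_poly_no_edges: "lex_poly n 0 = monom 1 n"
  by (cases n; cases "n - 1") (auto simp: dom_op_one)

text \<open>Extends the star formula to \<open>s = a\<close>, where the recursion already takes the
  dominating branch.\<close>

lemma lex_poly_star: "s \<le> a \<Longrightarrow> lex_poly (Suc a) s = monom 1 (Suc a) + of_nat s * monom 1 (a - 1)"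
  by (cases a) (auto simp: lex_poly_no_edges dom_op_monom_Suc dom_op_one)

lemma dom_op_lex_poly: "dom_op (lex_poly n e) = lex_poly (Suc n) (e + n)"
  by simp

lemma iso_op_colex_poly: "e \<le> n choose 2 \<Longrightarrow> iso_op (colex_poly n e) = colex_poly (Suc n) e"
  by simp

text \<open>The lex graph has \<open>q\<close> dominating vertices over a star with \<open>s\<close>
  edges on the other \<open>N\<close> vertices; the two terms use no edge or one edge of that star.
  If \<open>N = 1\<close> then \<open>s = 0\<close>, so the truncated \<open>N - 2\<close> is
  harmless.\<close>

lemma lex_poly_eq:
  assumes "e + (N choose 2) = (q + N choose 2) + s" "s < N"
  shows "lex_poly (q + N) e = dom_indep q N + of_nat s * dom_indep q (N - 2)"
  using assms
proof (induction q arbitrary: e)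
  case 0
  then have "e = s" by simp
  obtain a where "N = Suc a" using 0 by (cases N) auto
  with 0 lex_poly_star[of s a] \<open>e = s\<close> show ?case
    by (simp add: dom_indep_def del: lex_poly.simps)
next
  case (Suc q)
  have le: "N choose 2 \<le> q + N choose 2"
    by (intro choose_2_mono) simp
  define e' where "e' = e - (q + N)"
  have e: "e = e' + (q + N)"
    using Suc.prems le by (simp add: Suc_choose_2 e'_def)
  have "lex_poly (q + N) e' = dom_indep q N + of_nat s * dom_indep q (N - 2)"
    using Suc.prems by (intro Suc.IH) (simp_all add: Suc_choose_2 e)
  then show ?case
    using dom_op_lex_poly[of "q + N" e']
    by (simp add: e op_linear dom_op_dom_indep del: lex_poly.simps)
qed

lemma lex_param:
  assumes "e \<le> n choose 2" "n \<ge> 1"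
  obtains q N s where "n = q + N" "s < N" "e + (N choose 2) = (n choose 2) + s"
proof -
  have "\<exists>q N s. n = q + N \<and> s < N \<and> e + (N choose 2) = (n choose 2) + s"
    using assms
  proof (induction n arbitrary: e)
    case (Suc n)
    show ?case
    proof (cases "e < Suc n")
      case True
      then have "Suc n = 0 + Suc n \<and> e < Suc n \<and> e + (Suc n choose 2) = (Suc n choose 2) + e"
        by simp
      then show ?thesis by blast
    next
      case False
      then have "n \<ge> 1" using Suc.prems by (cases n) (auto simp: Suc_choose_2)
      then obtain q N s where "n = q + N" "s < N" "e - n + (N choose 2) = (n choose 2) + s"
        using Suc.IH[of "e - n"] Suc.prems False
        by (metis Suc_choose_2 diff_le_mono add_diff_cancel_right')
      then have "Suc n = Suc q + N \<and> s < N \<and> e + (N choose 2) = (Suc n choose 2) + s"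
        using False by (simp add: Suc_choose_2)
      then show ?thesis by blast
    qed
  qed simp
  then show thesis using that by blast
qed

lemma colex_poly_complete: "colex_poly n (n choose 2) = iso_clique 0 n"
proof (induction n)
  case 0
  then show ?case by (simp add: iso_clique_def)
next
  case (Suc n)
  then show ?case
    by (cases n) (simp_all add: Suc_choose_2 dom_op_iso_clique_0 iso_op_iso_clique iso_clique_1,
      simp add: iso_clique_def dom_op_one iso_op_def monom_Suc)
qed

text \<open>A clique on \<open>d\<close> vertices plus one vertex joined to \<open>t\<close> of
  them: the extra vertex is unmatched, or matched in one of \<open>t\<close> ways. The case
  \<open>t = 0\<close> is separate because it falls in the isolated branch of the recursion.\<close>

lemma colex_poly_clique_vertex:
  "t \<le> d \<Longrightarrow> colex_poly (Suc d) ((d choose 2) + t) = iso_clique 1 d + of_nat t * iso_clique 0 (d - 1)"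
proof (induction d arbitrary: t)
  case 0
  then show ?case by (simp add: iso_clique_def)
next
  case (Suc d)
  show ?case
  proof (cases t)
    case 0
    then show ?thesis
      using iso_op_colex_poly[of "Suc d choose 2" "Suc d"]
      by (simp add: colex_poly_complete iso_op_iso_clique del: colex_poly.simps)
  next
    case (Suc t')
    then have "t' \<le> d" using Suc.prems by simp
    have "colex_poly (Suc (Suc d)) ((Suc d choose 2) + t) = dom_op (colex_poly (Suc d) ((d choose 2) + t'))"
      using Suc by (subst colex_poly.simps(2)) (simp add: Suc_choose_2 del: colex_poly.simps)
    also have "\<dots> = dom_op (iso_clique 1 d + of_nat t' * iso_clique 0 (d - 1))"
      using Suc.IH[OF \<open>t' \<le> d\<close>] by simp
    also have "\<dots> = iso_clique 1 (Suc d) + of_nat t * iso_clique 0 d"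
    proof (cases "t' = 0")
      case True
      then show ?thesis using Suc
        by (simp add: op_linear dom_op_iso_clique_Suc)
    next
      case False
      then obtain d' where "d = Suc d'" using \<open>t' \<le> d\<close> by (cases d) auto
      then show ?thesis using Suc
        by (simp add: op_linear dom_op_iso_clique_0 dom_op_iso_clique_Suc algebra_simps)
    qed
    finally show ?thesis by simp
  qed
qed

lemma colex_poly_eq:
  assumes "t \<le> d"
  shows "colex_poly (Suc d + j) ((d choose 2) + t)
    = iso_clique (Suc j) d + of_nat t * iso_clique j (d - 1)"
proof (induction j)
  case 0
  then show ?case using colex_poly_clique_vertex[OF assms] by simp
next
  case (Suc j)
  have "(d choose 2) + t \<le> Suc d choose 2" using assms by (simp add: Suc_choose_2)
  also have "\<dots> \<le> Suc d + j choose 2" by (intro choose_2_mono) simp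
  finally have "colex_poly (Suc d + Suc j) ((d choose 2) + t)
      = iso_op (colex_poly (Suc d + j) ((d choose 2) + t))"
    using iso_op_colex_poly by (simp del: colex_poly.simps)
  then show ?case unfolding Suc
    by (simp add: op_linear iso_op_iso_clique)
qed

lemma colex_param:
  assumes "e \<le> n choose 2" "n \<ge> 1"
  obtains d t j where "n = Suc d + j" "t \<le> d" "e = (d choose 2) + t"
proof -
  have "\<exists>d t j. n = Suc d + j \<and> t \<le> d \<and> e = (d choose 2) + t"
    using assms
  proof (induction n)
    case (Suc n)
    show ?case
    proof (cases "e \<le> n choose 2 \<and> n \<ge> 1")
      case True
      then obtain d t j where "n = Suc d + j" "t \<le> d" "e = (d choose 2) + t"
        using Suc.IH by blast
      then have "Suc n = Suc d + Suc j \<and> t \<le> d \<and> e = (d choose 2) + t"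
        by simp
      then show ?thesis by blast
    next
      case False
      then have "Suc n = Suc n + 0 \<and> e - (n choose 2) \<le> n \<and> e = (n choose 2) + (e - (n choose 2))"
        using Suc.prems by (cases n) (auto simp: Suc_choose_2)
      then show ?thesis by blast
    qed
  qed simp
  then show thesis using that by blast
qed

section \<open>Comparing lex and colex polynomials\<close>

text \<open>
  A clique on \<open>c + 1\<close> vertices with \<open>r\<close> pendant edges at one of its vertices is turned into the lex graph
  by replacing the edges at another clique vertex with pendant edges at the first one. When the
  first vertex thereby becomes dominating, it is split off and the rest is treated recursively.
\<close>

lemma lex_le_clique_family:
  assumes "r \<le> a" "c \<le> a + 1"
  shows "lex_poly (a + Suc c) ((Suc c choose 2) + r)
    \<preceq> iso_clique a (Suc c) + of_nat r * iso_clique (a - 1) c"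
  using assms
proof (induction c arbitrary: a r rule: less_induct)
  case (less c)
  show ?case
  proof (cases c)
    case 0
    then show ?thesis
      using less.prems lex_poly_star[of r a]
      by (simp add: iso_clique_1 iso_clique_0 Suc_choose_2 del: lex_poly.simps)
  next
    case c: (Suc b)
    show ?thesis
    proof (cases "r + b \<le> a")
      case True
      \<comment> \<open>Another clique vertex keeps only its edge to the first one, so it becomes
        pendant; its \<open>b\<close> other edges become pendant edges as well. The clique shrinks
        by one vertex, and by \<open>iso_clique_Suc_Suc\<close> the loss is \<open>r * b\<close>
        times a nonnegative polynomial.\<close>
      have IH: "lex_poly (a + 1 + Suc b) ((Suc b choose 2) + (r + b + 1))
          \<preceq> iso_clique (a + 1) (Suc b) + of_nat (r + b + 1) * iso_clique a b"
        using less.IH[of b "r + b + 1" "a + 1"] True c by (simp del: lex_poly.simps)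
      have edges: "(Suc c choose 2) + r = (Suc b choose 2) + (r + b + 1)"
        by (simp add: c Suc_choose_2)
      have "iso_clique (a + 1) (Suc b) + of_nat (r + b + 1) * iso_clique a b
          \<preceq> iso_clique a (Suc c) + of_nat r * iso_clique (a - 1) c"
      proof (cases "r = 0 \<or> b = 0")
        case True
        then consider "r = 0" | a' where "b = 0" "a = Suc a'"
          using less.prems by (cases a) auto
        then show ?thesis
          by cases (simp_all add: c iso_clique_Suc_Suc iso_clique_1 algebra_simps)
      next
        case False
        then obtain a' b' where ab: "a = Suc a'" "b = Suc b'"
          using less.prems by (cases a; cases b) auto
        show ?thesis
          by (rule coeff_le_add_of_nat[of "iso_clique a' b'" _ _ "r * b"])
            (simp_all add: ab c iso_clique_Suc_Suc algebra_simps)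
      qed
      with IH show ?thesis
        unfolding edges using c by (auto intro: coeff_le_trans)
    next
      case False
      \<comment> \<open>The \<open>i\<close> vertices still isolated absorb only \<open>i\<close> of
        the \<open>b\<close> edges, making the first vertex dominating, and \<open>r'\<close> edges
        are left over. These run from the stripped vertex into a clique on \<open>b\<close>
        vertices, which gives the same polynomial as \<open>r'\<close> pendant edges at one vertex
        of that clique. The slack \<open>k\<close> exists because
        \<open>c \<le> a + 1\<close>.\<close>
      define r' where "r' = r + b - a"
      define k where "k = a - b"
      define i where "i = a - r"
      have a: "a = r' + k + i" and r: "r = r' + k" and b: "b = i + r'" and "b > 0"
        using less.prems False c by (auto simp: r'_def k_def i_def)
      obtain b' where b': "b = Suc b'" using \<open>b > 0\<close> by (cases b) auto
      have "a > 0" using a b \<open>b > 0\<close> by linarith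
      then obtain a' where a': "a = Suc a'" by (cases a) auto
      have "lex_poly (a + 1 + Suc b') ((Suc b' choose 2) + r')
          \<preceq> iso_clique (a + 1) (Suc b') + of_nat r' * iso_clique a b'"
      proof -
        have "b' < c" "r' \<le> a + 1" "b' \<le> a + 1 + 1"
          using a b b' c by auto
        from less.IH[OF this] show ?thesis by simp
      qed
      moreover have "Suc (a + 1 + Suc b') = a + Suc c"
        using b' c by simp
      moreover have "(Suc b' choose 2) + r' + (a + 1 + Suc b') = (Suc c choose 2) + r"
        using a b r c unfolding b'[symmetric] by (simp add: Suc_choose_2)
      ultimately have "lex_poly (a + Suc c) ((Suc c choose 2) + r)
          \<preceq> dom_op (iso_clique (a + 1) (Suc b') + of_nat r' * iso_clique a b')"
        using dom_op_mono dom_op_lex_poly by metis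
      also have "dom_op (iso_clique (a + 1) (Suc b') + of_nat r' * iso_clique a b')
          \<preceq> iso_clique a (Suc c) + of_nat r * iso_clique a' c"
      proof (rule coeff_le_add_of_nat[of "iso_clique a' b'" _ _ "i * k"])
        have sp: "(of_nat (Suc a') :: int poly) = of_nat r' + of_nat k + of_nat i"
          "(of_nat (Suc b') :: int poly) = of_nat i + of_nat r'"
          using a a' b b' by (metis of_nat_add)+
        show "iso_clique a (Suc c) + of_nat r * iso_clique a' c =
          dom_op (iso_clique (a + 1) (Suc b') + of_nat r' * iso_clique a b')
            + of_nat (i * k) * iso_clique a' b'"
          unfolding b' a' c r Suc_eq_plus1[symmetric] op_linear dom_op_iso_clique_Suc iso_clique_Suc_Suc
            of_nat_Suc[of "Suc a'"] of_nat_Suc[of "Suc b'"] sp of_nat_add of_nat_mult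
          by (simp add: algebra_simps)
      qed simp
      finally show ?thesis using a' by simp
    qed
  qed
qed

text \<open>
  The complementary statement: the graph consists of \<open>c + 1\<close> independent vertices, all joined to a
  clique on \<open>a\<close> vertices, with \<open>z\<close> edges at one of the independent vertices deleted.
  The deletion term is moved to the left-hand side.
\<close>

lemma colex_le_dom_family:
  assumes "z \<le> a" "c \<le> a + 1" "e + (Suc c choose 2) + z = (a + Suc c choose 2)"
  shows "colex_poly (a + Suc c) e + of_nat z * dom_indep (a - 1) c \<preceq> dom_indep a (Suc c)"
  using assms
proof (induction c arbitrary: a z e rule: less_induct)
  case (less c)
  show ?case
  proof (cases c)
    case 0
    \<comment> \<open>With one independent vertex the graph is a clique on \<open>a + 1\<close>
      vertices with \<open>z\<close> edges at one vertex deleted. This is already a colex graph, so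
      equality holds.\<close>
    have "colex_poly (Suc a) e + of_nat z * dom_indep (a - 1) 0 = dom_indep a 1"
    proof -
      have "e = (a choose 2) + (a - z)" "a - z \<le> a"
        using less.prems 0 by (simp_all add: Suc_choose_2)
      then have eq: "colex_poly (Suc a) e = iso_clique 1 a + of_nat (a - z) * iso_clique 0 (a - 1)"
        using colex_poly_clique_vertex by blast
      have [simp]: "iso_clique 0 q = dom_indep q 0" for q
        by (simp add: iso_clique_def dom_op_clique)
      have "(of_nat a :: int poly) = of_nat (a - z) + of_nat z"
        using less.prems by (metis le_add_diff_inverse2 of_nat_add)
      then have "of_nat (a - z) * dom_indep (a - 1) 0 + of_nat z * dom_indep (a - 1) 0
          = of_nat a * dom_indep (a - 1) 0"
        by (metis distrib_right)
      moreover have "iso_clique 1 a + of_nat a * dom_indep (a - 1) 0 = dom_indep a 1"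
      proof (cases a)
        case 0
        then show ?thesis by (simp add: iso_clique_def dom_indep_def iso_op_def monom_Suc)
      next
        case (Suc a')
        have "iso_clique 1 a = iso_op (dom_indep a 0)"
          by (simp add: iso_clique_def dom_op_clique)
        then show ?thesis using iso_op_dom_indep_Suc[of a' 0] Suc
          by (simp add: algebra_simps)
      qed
      ultimately show ?thesis unfolding eq by (simp add: algebra_simps)
    qed
    then show ?thesis using 0 by simp
  next
    case c: (Suc b)
    show ?thesis
    proof (cases "z + b \<le> a")
      case True
      \<comment> \<open>The previous move in the complement: a second independent vertex joins the
        clique, and the first one gives up \<open>b\<close> edges for it. The first one then lacks
        \<open>z + b + 1\<close> edges to the clique, counting the missing edge between these
        two.\<close>
      have IH: "colex_poly (a + 1 + Suc b) e + of_nat (z + b + 1) * dom_indep a b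
          \<preceq> dom_indep (a + 1) (Suc b)"
        using less.IH[of b "z + b + 1" "a + 1" e] True c less.prems
        by (simp add: Suc_choose_2 del: colex_poly.simps)
      show ?thesis
      proof (cases "z = 0 \<or> b = 0")
        case True
        then consider "z = 0" | a' where "b = 0" "a = Suc a'"
          using less.prems by (cases a) auto
        then show ?thesis
          using IH by cases (simp_all add: c dom_indep_Suc_Suc dom_indep_Suc_0 coeff_le_def algebra_simps
            del: colex_poly.simps)
      next
        case False
        then obtain a' b' where ab: "a = Suc a'" "b = Suc b'"
          using less.prems by (cases a; cases b) auto
        have "dom_indep (a + 1) (Suc b) - of_nat (z + b + 1) * dom_indep a b
            \<preceq> dom_indep a (Suc c) - of_nat z * dom_indep a' c"
          by (rule coeff_le_add_of_nat[of "dom_indep a' b'" _ _ "z * b"])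
            (simp_all add: ab c dom_indep_Suc_Suc algebra_simps)
        from coeff_le_diff_trans[OF IH this] show ?thesis
          unfolding c ab by (simp del: colex_poly.simps)
      qed
    next
      case False
      \<comment> \<open>The first independent vertex has only \<open>i\<close> edges to give up. It
        becomes isolated and is split off by \<open>iso_op\<close>, while the vertex joining the
        clique still lacks \<open>z'\<close> edges.\<close>
      define z' where "z' = z + b - a"
      define k where "k = a - b"
      define i where "i = a - z"
      have a: "a = z' + k + i" and z: "z = z' + k" and b: "b = i + z'" and "b > 0"
        using less.prems False c by (auto simp: z'_def k_def i_def)
      obtain b' where b': "b = Suc b'" using \<open>b > 0\<close> by (cases b) auto
      have "a > 0" using a b \<open>b > 0\<close> by linarith
      then obtain a' where a': "a = Suc a'" by (cases a) auto
      have edges: "e + (Suc b' choose 2) + z' = (a + 1 + Suc b' choose 2)"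
        using less.prems(3) a b b' c z by (simp add: Suc_choose_2 algebra_simps)
      have "b' < c" "z' \<le> a + 1" "b' \<le> a + 1 + 1"
        using a b b' c by auto
      from less.IH[OF this edges]
      have "colex_poly (a + 1 + Suc b') e + of_nat z' * dom_indep a b' \<preceq> dom_indep (a + 1) (Suc b')"
        by simp
      from iso_op_mono[OF this]
      have "colex_poly (a + Suc c) e + of_nat z' * iso_op (dom_indep a b') \<preceq> iso_op (dom_indep (a + 1) (Suc b'))"
        unfolding op_linear using iso_op_colex_poly[of e "a + 1 + Suc b'"] edges b' c
        by (simp del: colex_poly.simps)
      moreover have "iso_op (dom_indep (a + 1) (Suc b')) - of_nat z' * iso_op (dom_indep a b')
          \<preceq> dom_indep a (Suc c) - of_nat z * dom_indep a' c"
      proof (rule coeff_le_add_of_nat[of "dom_indep a' b'" _ _ "i * k"])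
        have sp: "(of_nat (Suc a') :: int poly) = of_nat z' + of_nat k + of_nat i"
          "(of_nat (Suc b') :: int poly) = of_nat i + of_nat z'"
          using a a' b b' by (metis of_nat_add)+
        have i1: "iso_op (dom_indep (Suc q) N) = dom_indep (Suc q) (Suc N) - of_nat (Suc q) * dom_indep q N"
          for q N by (simp add: iso_op_dom_indep_Suc)
        show "dom_indep a (Suc c) - of_nat z * dom_indep a' c =
          iso_op (dom_indep (a + 1) (Suc b')) - of_nat z' * iso_op (dom_indep a b')
            + of_nat (i * k) * dom_indep a' b'"
          unfolding b' a' c z Suc_eq_plus1[symmetric] i1
          unfolding dom_indep_Suc_Suc
            of_nat_Suc[of "Suc a'"] of_nat_Suc[of "Suc b'"] sp of_nat_add of_nat_mult
          by (simp add: algebra_simps)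
      qed simp
      ultimately show ?thesis
        unfolding a' diff_Suc_1 by (rule coeff_le_diff_trans)
    qed
  qed
qed

text \<open>A lex graph plus an isolated vertex is compared with the lex or colex graph having the
  same number of edges. The cases depend on whether the new vertex can be attached to all dominating
  vertices and on how large the clique part is.\<close>

lemma iso_op_lex_poly:
  assumes "e \<le> n choose 2"
  shows "lex_poly (Suc n) e \<preceq> iso_op (lex_poly n e) \<or> colex_poly (Suc n) e \<preceq> iso_op (lex_poly n e)"
proof (cases "n = 0")
  case True
  then show ?thesis using assms by (simp add: dom_op_one iso_op_def monom_Suc)
next
  case False
  then have "n \<ge> 1" by simp
  obtain q N s where n: "n = q + N" and s: "s < N" and e: "e + (N choose 2) = (n choose 2) + s"
    using lex_param[OF assms \<open>n \<ge> 1\<close>] by blast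
  have lex: "lex_poly n e = dom_indep q N + of_nat s * dom_indep q (N - 2)"
    using lex_poly_eq e s n by simp
  show ?thesis
  proof (cases q)
    case 0
    obtain M where M: "N = Suc M" using s by (cases N) auto
    have "e = s" using e n 0 by simp
    then have "iso_op (lex_poly n e) = monom 1 (Suc N) + of_nat s * iso_op (monom 1 (N - 2))"
      unfolding lex by (simp add: op_linear iso_op_monom dom_indep_def 0)
    also have "\<dots> = lex_poly (Suc n) e"
      using s n 0 \<open>e = s\<close> M by (cases M) (simp_all add: iso_op_monom)
    finally show ?thesis by simp
  next
    case q: (Suc p)
    have i1: "iso_op (dom_indep (Suc q) N) = dom_indep (Suc q) (Suc N) - of_nat (Suc q) * dom_indep q N"
          for q N by (simp add: iso_op_dom_indep_Suc)
    consider "N = 1" | M where "N = Suc (Suc M)" "s \<ge> q" | M where "N = Suc (Suc M)" "s < q" "q < N"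
      | M where "N = Suc (Suc M)" "q \<ge> N"
      using s by (metis One_nat_def less_zeroE not_less old.nat.exhaust)
    then show ?thesis
    proof cases
      case 1
      \<comment> \<open>The graph is complete, and a complete graph plus an isolated vertex is a
        colex graph.\<close>
      then have "e = n choose 2" "lex_poly n e = dom_indep q 1"
        using s e lex by (simp_all add: Suc_choose_2)
      moreover have "colex_poly n (n choose 2) = dom_indep q 1"
        unfolding colex_poly_complete using 1 n
        by (simp add: iso_clique_def dom_indep_Suc_0 dom_op_clique del: funpow.simps)
      ultimately have "iso_op (lex_poly n e) = colex_poly (Suc n) e"
        using iso_op_colex_poly[of e n] by simp
      then show ?thesis by simp
    next
      case (2 M)
      \<comment> \<open>The star at the first non-dominating vertex has enough edges to supply the
        \<open>q\<close> edges that join the new vertex to all dominating vertices; \<open>u\<close>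
        edges remain in the star.\<close>
      obtain u where u: "s = q + u" using 2 le_Suc_ex by blast
      obtain v where v: "Suc M = s + v" using 2 s by (metis less_Suc_eq_le le_Suc_ex)
      have "lex_poly (q + Suc N) e = dom_indep q (Suc N) + of_nat u * dom_indep q (Suc N - 2)"
        using e s n u by (intro lex_poly_eq) (simp_all add: Suc_choose_2)
      moreover have "dom_indep q (Suc N) + of_nat u * dom_indep q (Suc N - 2) \<preceq> iso_op (lex_poly n e)"
      proof (rule coeff_le_add_of_nat[of "dom_indep p M" _ _ "q * v"])
        have sp: "(of_nat M :: int poly) = of_nat p + of_nat u + of_nat v"
          using u v q by (metis of_nat_add add_Suc nat.inject)
        show "iso_op (lex_poly n e) = dom_indep q (Suc N) + of_nat u * dom_indep q (Suc N - 2)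
          + of_nat (q * v) * dom_indep p M"
          unfolding lex op_linear
          unfolding u 2(1) of_nat_mult of_nat_add
          unfolding q diff_Suc_Suc diff_zero numeral_2_eq_2 i1
          unfolding dom_indep_Suc_Suc of_nat_Suc sp
          by (simp add: algebra_simps)
      qed simp
      ultimately show ?thesis using n by (simp del: lex_poly.simps)
    next
      case (3 M)
      \<comment> \<open>The star is too small, so one dominating vertex stops being dominating and
        becomes the star centre. Its \<open>N\<close> edges to the lower vertices and the
        \<open>s\<close> star edges, less the \<open>p\<close> edges attaching the new vertex, leave
        \<open>s'\<close>.\<close>
      obtain u where u: "Suc M = q + u" using 3 by (metis less_Suc_eq_le le_Suc_ex)
      obtain v where v: "p = s + v" using 3 q by (metis less_Suc_eq_le le_Suc_ex)
      define s' where "s' = N + s - p"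
      have s': "s' + v = N" using v 3 q by (simp add: s'_def)
      have sN: "N + s = s' + p" using v s' by simp
      have "lex_poly (p + Suc (Suc N)) e
          = dom_indep p (Suc (Suc N)) + of_nat s' * dom_indep p (Suc (Suc N) - 2)"
        using e n q sN s' by (intro lex_poly_eq) (simp_all add: Suc_choose_2)
      moreover have "dom_indep p (Suc (Suc N)) + of_nat s' * dom_indep p (Suc (Suc N) - 2)
          \<preceq> iso_op (lex_poly n e)"
      proof (rule coeff_le_add_of_nat[of "dom_indep p M" _ _ "s * u"])
        have sp: "(of_nat s' :: int poly) = of_nat N - of_nat v"
          using s' by (metis add_diff_cancel_right' of_nat_add)
        have sq: "(of_nat (Suc M) :: int poly) = of_nat s + of_nat v + 1 + of_nat u"
          using u v q by (metis of_nat_add of_nat_Suc add.commute)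
        have sr: "(of_nat (Suc p) :: int poly) = of_nat s + of_nat v + 1"
          using v q by simp
        show "iso_op (lex_poly n e) = dom_indep p (Suc (Suc N)) + of_nat s' * dom_indep p (Suc (Suc N) - 2)
          + of_nat (s * u) * dom_indep p M"
          unfolding lex op_linear
          unfolding sp 3(1) of_nat_mult
          unfolding q diff_Suc_Suc diff_zero numeral_2_eq_2 i1
          unfolding dom_indep_Suc_Suc
            of_nat_Suc[of "Suc (Suc M)"] of_nat_Suc[of "Suc M"] sq sr
          by (simp add: algebra_simps)
      qed simp
      ultimately show ?thesis using n q by (simp del: lex_poly.simps)
    next
      case (4 M)
      \<comment> \<open>The colex graph is no worse than the lex graph already on \<open>n\<close>
        vertices: the star centre is regarded as a clique vertex with \<open>z\<close> edges
        missing, and the preceding family bound applies with \<open>q + 1\<close> clique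
        vertices.\<close>
      obtain z where z: "Suc M = s + z" using 4 s by (metis less_Suc_eq_le le_Suc_ex)
      have "colex_poly (q + 1 + Suc M) e + of_nat z * dom_indep (q + 1 - 1) M \<preceq> dom_indep (q + 1) (Suc M)"
        using 4 s z n e by (intro colex_le_dom_family) (simp_all add: Suc_choose_2)
      moreover have "dom_indep (q + 1) (Suc M) = lex_poly n e + of_nat z * dom_indep q M"
      proof -
        have sp: "(of_nat (Suc M) :: int poly) = of_nat s + of_nat z"
          using z by (metis of_nat_add)
        show ?thesis
          unfolding lex 4(1) Suc_eq_plus1[symmetric] dom_indep_Suc_Suc sp by (simp add: algebra_simps)
      qed
      ultimately have "colex_poly n e \<preceq> lex_poly n e"
        using n 4 by (simp add: coeff_le_def del: colex_poly.simps lex_poly.simps)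
      from iso_op_mono[OF this] show ?thesis
        unfolding iso_op_colex_poly[OF assms] ..
    qed
  qed
qed

text \<open>The dual step: a dominating vertex is added to a clique on \<open>d\<close> vertices, a
  vertex joined to \<open>t\<close> of them, and \<open>j\<close> isolated vertices. The edges from
  the new vertex to those \<open>j\<close> vertices have to be relocated.\<close>

lemma dom_op_colex_poly:
  assumes "e \<le> n choose 2"
  shows "lex_poly (Suc n) (e + n) \<preceq> dom_op (colex_poly n e)
    \<or> colex_poly (Suc n) (e + n) \<preceq> dom_op (colex_poly n e)"
proof (cases "n = 0")
  case True
  then show ?thesis using assms by (simp add: dom_op_one iso_op_def monom_Suc)
next
  case False
  then have "n \<ge> 1" by simp
  obtain d t j where n: "n = Suc d + j" and t: "t \<le> d" and e: "e = (d choose 2) + t"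
    using colex_param[OF assms \<open>n \<ge> 1\<close>] by blast
  have colex: "colex_poly n e = iso_clique (Suc j) d + of_nat t * iso_clique j (d - 1)"
    unfolding n e by (rule colex_poly_eq[OF t])
  consider "t + j \<le> d" | i where "t + j > d" "j = Suc i" "j \<le> d" "t > 0" | "j > d"
    using t by (cases j; cases t) force+
  then show ?thesis
  proof cases
    case 1
    \<comment> \<open>All \<open>j\<close> edges fit at the partially joined vertex, which ends with
      \<open>t + j + 1\<close> neighbours in the clique on \<open>d + 1\<close> vertices.\<close>
    have "colex_poly (Suc (Suc d) + j) ((Suc d choose 2) + (t + j + 1))
        = iso_clique (Suc j) (Suc d) + of_nat (t + j + 1) * iso_clique j (Suc d - 1)"
      using 1 by (intro colex_poly_eq) simp
    moreover have "(Suc d choose 2) + (t + j + 1) = e + n"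
      using e n by (simp add: Suc_choose_2)
    moreover have "iso_clique (Suc j) (Suc d) + of_nat (t + j + 1) * iso_clique j (Suc d - 1)
        \<preceq> dom_op (colex_poly n e)"
    proof (cases "t = 0 \<or> j = 0")
      case True
      then consider "t = 0" | c where "j = 0" "d = Suc c"
        using t by (cases d) auto
      then show ?thesis
        by cases (simp_all add: colex op_linear dom_op_iso_clique_Suc dom_op_iso_clique_0 algebra_simps)
    next
      case False
      then obtain i c where jd: "j = Suc i" "d = Suc c" using t by (cases j; cases d) auto
      show ?thesis
        by (rule coeff_le_add_of_nat[of "iso_clique i c" _ _ "t * j"])
          (simp_all add: jd colex op_linear dom_op_iso_clique_Suc algebra_simps)
    qed
    moreover have "Suc (Suc d) + j = Suc n" using n by simp
    ultimately show ?thesis by metis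
  next
    case (2 i)
    \<comment> \<open>The partially joined vertex is completed to a clique vertex, using
      \<open>y\<close> of the \<open>j\<close> edges; the remaining \<open>u\<close> edges go to the
      next vertex.\<close>
    define u where "u = t + j - d"
    define x where "x = d - j"
    define y where "y = d - t"
    have d: "d = x + y + u" and t: "t = x + u" and j: "j = y + u"
      using 2 t by (auto simp: u_def x_def y_def)
    obtain c where c: "d = Suc c" using 2 by (cases d) auto
    have "colex_poly (Suc (Suc (Suc d)) + i) ((Suc (Suc d) choose 2) + u)
        = iso_clique (Suc i) (Suc (Suc d)) + of_nat u * iso_clique i (Suc (Suc d) - 1)"
      using d by (intro colex_poly_eq) simp
    moreover have "(Suc (Suc d) choose 2) + u = e + n"
      using e n d t j by (simp add: Suc_choose_2)
    moreover have "iso_clique (Suc i) (Suc (Suc d)) + of_nat u * iso_clique i (Suc (Suc d) - 1)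
        \<preceq> dom_op (colex_poly n e)"
    proof (rule coeff_le_add_of_nat[of "iso_clique i c" _ _ "x * y"])
      have sp: "(of_nat (Suc c) :: int poly) = of_nat x + of_nat y + of_nat u"
        "(of_nat (Suc i) :: int poly) = of_nat y + of_nat u"
        using c d j 2 by (metis of_nat_add)+
      show "dom_op (colex_poly n e) = iso_clique (Suc i) (Suc (Suc d))
          + of_nat u * iso_clique i (Suc (Suc d) - 1) + of_nat (x * y) * iso_clique i c"
        unfolding colex op_linear
        unfolding t 2(2) of_nat_mult of_nat_add
        unfolding c diff_Suc_1 dom_op_iso_clique_Suc iso_clique_Suc_Suc
          of_nat_Suc[of "Suc c"] of_nat_Suc[of "Suc i"] sp
        by (simp add: algebra_simps)
    qed simp
    moreover have "Suc (Suc (Suc d)) + i = Suc n" using n 2 by simp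
    ultimately show ?thesis by metis
  next
    case 3
    have "lex_poly n e \<preceq> colex_poly n e"
    proof (cases d)
      case 0
      then have "e = 0" "colex_poly n e = monom 1 n"
        unfolding colex using t n e by (simp_all add: iso_clique_0)
      then show ?thesis by (simp add: lex_poly_no_edges)
    next
      case (Suc c)
      \<comment> \<open>The \<open>t\<close> edges at the extra vertex contribute the same
        polynomial as \<open>t\<close> pendant edges at one clique vertex, so the family bound
        compares the two graphs before the dominating vertex is added.\<close>
      have "lex_poly (Suc j + Suc c) ((Suc c choose 2) + t)
          \<preceq> iso_clique (Suc j) (Suc c) + of_nat t * iso_clique (Suc j - 1) c"
        using 3 t Suc by (intro lex_le_clique_family) simp_all
      moreover have "Suc j + Suc c = n" "(Suc c choose 2) + t = e"
        using n e Suc by simp_all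
      ultimately show ?thesis unfolding colex by (simp add: Suc del: lex_poly.simps)
    qed
    from dom_op_mono[OF this] show ?thesis unfolding dom_op_lex_poly ..
  qed
qed

section \<open>The matching polynomial of a graph\<close>

definition matchings :: "'a set set \<Rightarrow> 'a set set set" where
  "matchings E = {M. M \<subseteq> E \<and> pairwise disjnt M}"

definition matching_poly :: "'a set \<Rightarrow> 'a set set \<Rightarrow> int poly" where
  "matching_poly V E = (\<Sum>M\<in>matchings E. monom 1 (card V - 2 * card M))"

lemma matchings_empty [simp]: "matchings {} = {{}}"
  by (auto simp: matchings_def)

lemma finite_edges: "finite V \<Longrightarrow> E \<subseteq> nsets V 2 \<Longrightarrow> finite E"
  by (meson finite_imp_finite_nsets finite_subset)

lemma finite_matchings: "finite E \<Longrightarrow> finite (matchings E)"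
  by (simp add: matchings_def)

lemma card_Union_matching:
  assumes "E \<subseteq> nsets V 2" "M \<in> matchings E"
  shows "card (\<Union>M) = 2 * card M"
proof -
  have "card (\<Union>M) = sum card M"
    using assms by (intro card_Union_disjoint) (auto simp: matchings_def nsets_def)
  also have "\<dots> = sum (\<lambda>_. 2) M"
    using assms by (intro sum.cong) (auto simp: matchings_def nsets_def)
  finally show ?thesis by simp
qed

lemma Union_matching_subset: "E \<subseteq> nsets V 2 \<Longrightarrow> M \<in> matchings E \<Longrightarrow> \<Union>M \<subseteq> V"
  by (auto simp: matchings_def nsets_def)

lemma card_matching_le:
  assumes "finite V" "E \<subseteq> nsets V 2" "M \<in> matchings E"
  shows "2 * card M \<le> card V"
  using card_mono[OF assms(1) Union_matching_subset[OF assms(2,3)]] card_Union_matching[OF assms(2,3)]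
  by simp

text \<open>No subtraction truncates, since a matching covers at most \<open>card V\<close>
  vertices; hence distinct matching sizes give distinct exponents.\<close>

lemma coeff_matching_poly:
  assumes "finite V" "E \<subseteq> nsets V 2" "2 * k \<le> card V"
  shows "coeff (matching_poly V E) (card V - 2 * k) = int (card {M \<in> matchings E. card M = k})"
proof -
  have fin: "finite (matchings E)"
    using assms by (simp add: finite_edges finite_matchings)
  have "coeff (matching_poly V E) (card V - 2 * k) = (\<Sum>M\<in>matchings E. if card M = k then 1 else 0)"
    unfolding matching_poly_def coeff_sum
  proof (rule sum.cong)
    fix M assume "M \<in> matchings E"
    then have "2 * card M \<le> card V" using assms card_matching_le by blast
    then show "coeff (monom 1 (card V - 2 * card M)) (card V - 2 * k) = (if card M = k then 1 else (0::int))"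
      using assms(3) by auto
  qed simp
  also have "\<dots> = int (card {M \<in> matchings E. card M = k})"
    using fin by (simp add: sum.If_cases Int_def)
  finally show ?thesis .
qed

lemma poly_matching_poly_1: "finite E \<Longrightarrow> poly (matching_poly V E) 1 = int (card (matchings E))"
  by (simp add: matching_poly_def poly_sum poly_monom)

lemma poly_1_mono:
  assumes "p \<preceq> q"
  shows "poly p 1 \<le> poly q 1"
proof -
  have "0 \<le> poly (q - p) 1"
    using assms unfolding poly_altdef coeff_le_def by (auto intro: sum_nonneg)
  then show ?thesis by simp
qed

lemma matching_poly_mono_inj:
  assumes "finite E" "inj_on g (matchings E')" "g ` matchings E' \<subseteq> matchings E"
    and "\<And>M. M \<in> matchings E' \<Longrightarrow> card (g M) = card M"
  shows "matching_poly V E' \<preceq> matching_poly V E"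
  unfolding coeff_le_def
proof
  fix i
  have "coeff (matching_poly V E') i = (\<Sum>M\<in>matchings E'. coeff (monom 1 (card V - 2 * card (g M))) i)"
    unfolding matching_poly_def coeff_sum using assms(4) by (intro sum.cong) auto
  also have "\<dots> = (\<Sum>M\<in>g ` matchings E'. coeff (monom 1 (card V - 2 * card M)) i)"
    using assms(2) by (simp add: sum.reindex)
  also have "\<dots> \<le> (\<Sum>M\<in>matchings E. coeff (monom 1 (card V - 2 * card M)) i)"
    using assms(1,3) by (intro sum_mono2) (auto simp: finite_matchings)
  finally show "coeff (matching_poly V E') i \<le> coeff (matching_poly V E) i"
    by (simp add: matching_poly_def coeff_sum)
qed

lemma iso_op_sum: "finite A \<Longrightarrow> iso_op (sum f A) = (\<Sum>x\<in>A. iso_op (f x))"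
  by (induction A rule: finite_induct) (simp_all add: op_linear, simp add: iso_op_def)

lemma dom_op_sum: "finite A \<Longrightarrow> dom_op (sum f A) = (\<Sum>x\<in>A. dom_op (f x))"
  by (induction A rule: finite_induct) (simp_all add: op_linear, simp add: dom_op_def)

lemma matching_poly_isolated:
  assumes "finite W" "v \<notin> W" "E \<subseteq> nsets W 2"
  shows "matching_poly (insert v W) E = iso_op (matching_poly W E)"
proof -
  have "finite (matchings E)" using assms by (simp add: finite_edges finite_matchings)
  moreover have "Suc (card W) - 2 * card M = Suc (card W - 2 * card M)" if "M \<in> matchings E" for M
    using card_matching_le[OF assms(1,3) that] by simp
  ultimately show ?thesis
    using assms by (simp add: matching_poly_def iso_op_sum iso_op_monom)
qed

lemma dom_op_monom: "dom_op (monom 1 a) = monom 1 (Suc a) + of_nat a * monom 1 (a - 1)"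
  by (cases a) (simp_all add: dom_op_monom_Suc dom_op_one)

text \<open>A matching either avoids \<open>v\<close>, or is a matching \<open>M\<close> of the rest
  plus an edge from \<open>v\<close> to one of the \<open>card W - 2 * card M\<close> uncovered
  vertices. These two cases are the two terms of \<open>dom_op\<close> on a monomial.\<close>

lemma matching_poly_dominating:
  assumes "finite W" "v \<notin> W" "F \<subseteq> nsets W 2"
  shows "matching_poly (insert v W) (F \<union> (\<lambda>w. {v, w}) ` W) = dom_op (matching_poly W F)"
proof -
  let ?E = "F \<union> (\<lambda>w. {v, w}) ` W"
  let ?S = "SIGMA M:matchings F. W - \<Union>M"
  let ?ext = "\<lambda>(M, w). insert {v, w} M"
  define m where "m M = (monom 1 (card (insert v W) - 2 * card M) :: int poly)" for M :: "'a set set"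
  have finF: "finite F" using assms by (simp add: finite_edges)
  then have fin: "finite (matchings F)" "finite (matchings ?E)"
    using assms(1) by (simp_all add: finite_matchings)
  have vF: "v \<notin> f" if "f \<in> F" for f
    using that assms by (auto simp: nsets_def)
  then have vM: "{v, w} \<notin> M" "v \<notin> \<Union>M" if "M \<in> matchings F" for M w
    using that by (auto simp: matchings_def)
  have inj: "inj_on ?ext ?S"
  proof (rule inj_onI, clarify)
    fix M w M' w'
    assume M: "M \<in> matchings F" "M' \<in> matchings F" and eq: "insert {v, w} M = insert {v, w'} M'"
    \<comment> \<open>The pair is recovered from the extended matching: \<open>M\<close> consists of
      the edges that miss \<open>v\<close>.\<close>
    have "M = {f \<in> insert {v, w} M. v \<notin> f}" "M' = {f \<in> insert {v, w'} M'. v \<notin> f}"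
      using vM M by auto
    then have "M = M'" using eq by simp
    moreover have "{v, w} = {v, w'}"
    proof -
      have "{v, w} \<in> insert {v, w'} M'" using eq by blast
      then show ?thesis using vM(1)[OF M(2), of w] by simp
    qed
    ultimately show "M = M' \<and> w = w'"
      by (auto simp: doubleton_eq_iff)
  qed
  have split: "matchings ?E = matchings F \<union> ?ext ` ?S"
  proof (intro equalityI subsetI)
    fix X assume X: "X \<in> matchings ?E"
    show "X \<in> matchings F \<union> ?ext ` ?S"
    proof (cases "X \<subseteq> F")
      case False
      then obtain w where w: "w \<in> W" "{v, w} \<in> X"
        using X by (auto simp: matchings_def)
      define M where "M = X - {{v, w}}"
      have disj: "disjnt {v, w} f" if "f \<in> M" for f
        using pairwiseD[of disjnt X "{v, w}" f] X w that by (auto simp: M_def matchings_def)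
      then have "M \<subseteq> F"
        using X unfolding M_def matchings_def by (auto simp: disjnt_def)
      then have "M \<in> matchings F"
        using X unfolding M_def matchings_def by (auto simp: pairwise_def)
      moreover have "w \<notin> \<Union>M" using disj by (auto simp: disjnt_def)
      moreover have "X = insert {v, w} M" using w by (auto simp: M_def)
      ultimately show ?thesis using w by force
    qed (use X in \<open>auto simp: matchings_def\<close>)
  next
    fix X assume "X \<in> matchings F \<union> ?ext ` ?S"
    then show "X \<in> matchings ?E"
    proof
      assume "X \<in> ?ext ` ?S"
      then obtain M w where M: "M \<in> matchings F" "w \<in> W" "w \<notin> \<Union>M" "X = insert {v, w} M" by auto
      have "disjnt {v, w} f" "disjnt f {v, w}" if "f \<in> M" for f
        using vM M that by (auto simp: disjnt_def)
      then show ?thesis using M by (auto simp: matchings_def pairwise_insert)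
    qed (auto simp: matchings_def)
  qed
  have disj: "matchings F \<inter> ?ext ` ?S = {}"
    using vM by auto
  have card_M: "finite M" "card (\<Union>M) = 2 * card M" "\<Union>M \<subseteq> W" "2 * card M \<le> card W"
    if "M \<in> matchings F" for M
    using that finF card_Union_matching[OF assms(3)] Union_matching_subset[OF assms(3)]
      card_matching_le[OF assms(1,3)]
    by (auto simp: matchings_def intro: finite_subset)
  have "matching_poly (insert v W) ?E = sum m (matchings F) + sum m (?ext ` ?S)"
    unfolding matching_poly_def m_def[symmetric] split
    using fin(1) assms(1) disj by (intro sum.union_disjoint) auto
  also have "sum m (?ext ` ?S) = (\<Sum>(M, w)\<in>?S. m (insert {v, w} M))"
    using sum.reindex[OF inj, of m] by (simp add: case_prod_unfold comp_def)
  also have "\<dots> = (\<Sum>M\<in>matchings F. \<Sum>w\<in>W - \<Union>M. m (insert {v, w} M))"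
    using fin(1) assms(1) by (subst sum.Sigma) auto
  also have "sum m (matchings F) + \<dots>
      = (\<Sum>M\<in>matchings F. m M + (\<Sum>w\<in>W - \<Union>M. m (insert {v, w} M)))"
    by (simp add: sum.distrib)
  also have "\<dots> = (\<Sum>M\<in>matchings F. dom_op (monom 1 (card W - 2 * card M)))"
  proof (rule sum.cong)
    fix M assume M: "M \<in> matchings F"
    have "m M = monom 1 (Suc (card W - 2 * card M))"
      using card_M[OF M] assms by (simp add: m_def Suc_diff_le)
    moreover have "(\<Sum>w\<in>W - \<Union>M. m (insert {v, w} M))
        = of_nat (card W - 2 * card M) * monom 1 (card W - 2 * card M - 1)"
    proof -
      have "(\<Sum>w\<in>W - \<Union>M. m (insert {v, w} M)) = (\<Sum>w\<in>W - \<Union>M. monom 1 (card W - 2 * card M - 1))"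
        using card_M[OF M] vM[OF M] assms by (intro sum.cong) (simp_all add: m_def)
      also have "card (W - \<Union>M) = card W - 2 * card M"
        using card_M[OF M] assms(1) by (metis card_Diff_subset finite_subset)
      ultimately show ?thesis by simp
    qed
    ultimately show "m M + (\<Sum>w\<in>W - \<Union>M. m (insert {v, w} M)) = dom_op (monom 1 (card W - 2 * card M))"
      by (simp add: dom_op_monom)
  qed simp
  also have "\<dots> = dom_op (matching_poly W F)"
    using fin(1) by (simp add: matching_poly_def dom_op_sum)
  finally show ?thesis .
qed

lemma matching_poly_star:
  assumes "finite E" "\<And>f. f \<in> E \<Longrightarrow> v \<in> f"
  shows "matching_poly V E = monom 1 (card V) + of_nat (card E) * monom 1 (card V - 2)"
proof -
  have "matchings E = insert {} ((\<lambda>f. {f}) ` E)"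
  proof (intro equalityI subsetI)
    fix M assume M: "M \<in> matchings E"
    then have "f = g" if "f \<in> M" "g \<in> M" for f g
      using that assms(2) unfolding matchings_def pairwise_def disjnt_def by blast
    then have "M = {} \<or> (\<exists>f. M = {f})" by blast
    then show "M \<in> insert {} ((\<lambda>f. {f}) ` E)"
      using M by (auto simp: matchings_def)
  qed (auto simp: matchings_def)
  then show ?thesis
    using assms(1) by (simp add: matching_poly_def sum.reindex image_iff)
qed

section \<open>Compression\<close>

text \<open>Edges at \<open>y\<close> whose image under swapping \<open>x\<close> and
  \<open>y\<close> is absent are replaced by that image. A matching using a new edge is swapped as a
  whole, which injects matchings of the new graph into matchings of the old one and preserves
  size.\<close>

lemma compression:
  assumes "finite V" "E \<subseteq> nsets V 2" "x \<in> V" "y \<noteq> x"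
    and "f \<in> E" "y \<in> f" "transpose x y ` f \<notin> E"
  obtains E' where "E' \<subseteq> nsets V 2" "card E' = card E" "matching_poly V E' \<preceq> matching_poly V E"
    "card {g \<in> E. x \<in> g} < card {g \<in> E'. x \<in> g}"
proof -
  define \<sigma> where "\<sigma> = image (transpose x y)"
  define B where "B = {g \<in> E. y \<in> g \<and> \<sigma> g \<notin> E}"
  define E' where "E' = (E - B) \<union> \<sigma> ` B"
  have finE: "finite E" using assms by (simp add: finite_edges)
  have invol [simp]: "\<sigma> (\<sigma> g) = g" for g
    by (simp add: \<sigma>_def image_image)
  then have inj: "inj \<sigma>" by (metis injI)
  have fixed: "\<sigma> g = g" if "x \<in> g \<longleftrightarrow> y \<in> g" for g
    using that unfolding \<sigma>_def by (rule transpose_image_eq)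
  have x_in: "x \<in> \<sigma> g \<longleftrightarrow> y \<in> g" for g
    by (auto simp: \<sigma>_def image_iff transpose_def)
  have B: "x \<notin> g" "y \<in> g" "g \<in> E" "\<sigma> g \<notin> E" if "g \<in> B" for g
    using that fixed[of g] by (auto simp: B_def)
  have "f \<in> B" using assms by (simp add: B_def \<sigma>_def)
  have "y \<in> V" using assms(2,5,6) by (auto simp: nsets_def)
  have sub: "E' \<subseteq> nsets V 2"
  proof
    fix g assume "g \<in> E'"
    then consider "g \<in> E" | h where "h \<in> E" "g = \<sigma> h" unfolding E'_def B_def by blast
    then show "g \<in> nsets V 2"
    proof cases
      case 2
      then have h: "h \<subseteq> V" "finite h" "card h = 2" using assms(2) by (auto simp: nsets_def)
      have "card (\<sigma> h) = 2"
        unfolding \<sigma>_def using h(3) by (simp add: card_image)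
      moreover have "\<sigma> h \<subseteq> V"
        using h(1) assms(3) \<open>y \<in> V\<close> by (auto simp: \<sigma>_def transpose_def)
      ultimately show ?thesis using h(2) 2 by (simp add: nsets_def \<sigma>_def)
    qed (use assms(2) in blast)
  qed
  have disj: "E \<inter> \<sigma> ` B = {}" using B by auto
  have "B \<subseteq> E" by (auto simp: B_def)
  then have "finite B" using finE finite_subset by blast
  have card_E': "card E' = card E"
  proof -
    have "card E' = card (E - B) + card (\<sigma> ` B)"
      unfolding E'_def using disj finE \<open>finite B\<close> by (intro card_Un_disjoint) auto
    also have "card (\<sigma> ` B) = card B"
      using inj by (meson card_image inj_on_subset subset_UNIV)
    finally show ?thesis
      using \<open>B \<subseteq> E\<close> finE \<open>finite B\<close> by (simp add: card_Diff_subset card_mono)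
  qed
  have "{g \<in> E. x \<in> g} \<subset> {g \<in> E'. x \<in> g}"
  proof
    show "{g \<in> E. x \<in> g} \<subseteq> {g \<in> E'. x \<in> g}" using B by (auto simp: E'_def)
    have "\<sigma> f \<in> {g \<in> E'. x \<in> g}" "\<sigma> f \<notin> {g \<in> E. x \<in> g}"
      using \<open>f \<in> B\<close> B x_in by (auto simp: E'_def)
    then show "{g \<in> E. x \<in> g} \<noteq> {g \<in> E'. x \<in> g}" by blast
  qed
  then have deg: "card {g \<in> E. x \<in> g} < card {g \<in> E'. x \<in> g}"
    using finE \<open>finite B\<close> by (intro psubset_card_mono) (auto simp: E'_def)
  \<comment> \<open>The new edge \<open>\<sigma> b\<close> in \<open>M\<close> occupies
    \<open>x\<close>, so any other edge of \<open>M\<close> avoids \<open>x\<close>. If it contains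
    \<open>y\<close>, it stayed in place because its swap already lies in \<open>E\<close>. Since
    \<open>b\<close> itself was removed from \<open>E'\<close>, swapped matchings are never
    matchings of \<open>E'\<close>, which separates the two cases of the injection below.\<close>
  have swap: "\<sigma> ` M \<subseteq> E" "\<not> \<sigma> ` M \<subseteq> E'" if M: "M \<in> matchings E'" "\<not> M \<subseteq> E" for M
  proof -
    obtain b where b: "b \<in> B" "\<sigma> b \<in> M"
      using M by (auto simp: matchings_def E'_def)
    show "\<sigma> ` M \<subseteq> E"
    proof
      fix g assume "g \<in> \<sigma> ` M"
      then obtain h where h: "h \<in> M" "g = \<sigma> h" by blast
      show "g \<in> E"
      proof (cases "h = \<sigma> b")
        case True
        then show ?thesis using b B h by simp
      next
        case False
        then have "disjnt h (\<sigma> b)" using M h b by (auto simp: matchings_def pairwise_def)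
        then have "x \<notin> h" using x_in[of b] B[OF b(1)] by (auto simp: disjnt_def)
        then have "h \<notin> \<sigma> ` B" using x_in B(2) by blast
        moreover have "h \<in> E'" using h(1) M(1) by (auto simp: matchings_def)
        ultimately have "h \<in> E" "h \<notin> B" unfolding E'_def by blast+
        then show ?thesis
          using \<open>x \<notin> h\<close> fixed[of h] h(2) unfolding B_def by (cases "y \<in> h") auto
      qed
    qed
    have "b \<in> \<sigma> ` M" using b(2) by (metis imageI invol)
    moreover have "b \<notin> E'"
      using b(1) B x_in by (auto simp: E'_def)
    ultimately show "\<not> \<sigma> ` M \<subseteq> E'" by blast
  qed
  define g where "g M = (if M \<subseteq> E then M else \<sigma> ` M)" for M
  have "matching_poly V E' \<preceq> matching_poly V E"
  proof (rule matching_poly_mono_inj[of _ g])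
    have "M = N" if "g M = g N" "M \<in> matchings E'" "N \<in> matchings E'" for M N
    proof -
      have *: "M' \<subseteq> E'" if "M' \<in> matchings E'" for M'
        using that by (auto simp: matchings_def)
      consider "M \<subseteq> E" "N \<subseteq> E" | "M \<subseteq> E" "\<not> N \<subseteq> E" | "\<not> M \<subseteq> E" "N \<subseteq> E"
        | "\<not> M \<subseteq> E" "\<not> N \<subseteq> E" by blast
      then show ?thesis
      proof cases
        case 2
        then have "M = \<sigma> ` N" using that(1) by (simp add: g_def)
        then show ?thesis using *[OF that(2)] swap(2)[OF that(3) 2(2)] by simp
      next
        case 3
        then have "N = \<sigma> ` M" using that(1) by (simp add: g_def)
        then show ?thesis using *[OF that(3)] swap(2)[OF that(2) 3(1)] by simp
      next
        case 4
        then show ?thesis using that(1) inj_image_eq_iff[OF inj] by (simp add: g_def)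
      qed (use that(1) in \<open>simp add: g_def\<close>)
    qed
    then show "inj_on g (matchings E')" unfolding inj_on_def by blast
    show "g ` matchings E' \<subseteq> matchings E"
    proof (clarify)
      fix M assume M: "M \<in> matchings E'"
      have "pairwise disjnt (\<sigma> ` M)"
        using M unfolding matchings_def pairwise_image
        by (auto simp: pairwise_def disjnt_def \<sigma>_def simp flip: image_Int)
      then show "g M \<in> matchings E"
        using M swap(1)[OF M] by (auto simp: g_def matchings_def)
    qed
    show "card (g M) = card M" for M
      using inj by (auto simp: g_def intro: card_image inj_on_subset)
  qed (rule finE)
  with sub card_E' deg show thesis using that by blast
qed

text \<open>Among the finitely many admissible edge sets, one with maximal degree at
  \<open>x\<close> admits no further compression towards \<open>x\<close>.\<close>

lemma reduction_to_dominating_or_isolated: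
  assumes "finite V" "E \<subseteq> nsets V 2" "x \<in> V"
  obtains E' where "E' \<subseteq> nsets V 2" "card E' = card E" "matching_poly V E' \<preceq> matching_poly V E"
    "(\<exists>v\<in>V. \<forall>f\<in>E'. v \<notin> f) \<or> (\<forall>y\<in>V - {x}. {x, y} \<in> E')"
proof -
  define C where "C = {E'. E' \<subseteq> nsets V 2 \<and> card E' = card E \<and> matching_poly V E' \<preceq> matching_poly V E}"
  have "finite (nsets V 2)" using assms(1) by (rule finite_imp_finite_nsets)
  then have "finite C" unfolding C_def by (auto intro: finite_subset[of _ "Pow (nsets V 2)"])
  moreover have "E \<in> C" using assms by (simp add: C_def)
  ultimately obtain E' where E': "E' \<in> C"
    and deg: "card {g \<in> E'. x \<in> g} = Max ((\<lambda>F. card {g \<in> F. x \<in> g}) ` C)"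
    using Max_in[of "(\<lambda>F. card {g \<in> F. x \<in> g}) ` C"] by fastforce
  have max: "card {g \<in> F. x \<in> g} \<le> card {g \<in> E'. x \<in> g}" if "F \<in> C" for F
    unfolding deg using \<open>finite C\<close> that by simp
  have sub: "E' \<subseteq> nsets V 2" using E' by (simp add: C_def)
  have closed: "transpose x z ` f \<in> E'" if z: "z \<noteq> x" "f \<in> E'" "z \<in> f" for z f
  proof (rule ccontr)
    assume "transpose x z ` f \<notin> E'"
    then obtain F where F: "F \<subseteq> nsets V 2" "card F = card E'" "matching_poly V F \<preceq> matching_poly V E'"
      "card {g \<in> E'. x \<in> g} < card {g \<in> F. x \<in> g}"
      using compression[OF assms(1) sub assms(3) z] by blast
    then have "F \<in> C" using E' coeff_le_trans by (auto simp: C_def)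
    with max F(4) show False by fastforce
  qed
  have "{x, y} \<in> E'" if y: "y \<in> V - {x}" "f \<in> E'" "y \<in> f" for y f
  proof -
    obtain z where z: "f = {y, z}" "z \<noteq> y"
      using y sub by (auto simp: nsets_def card_2_iff doubleton_eq_iff)
    show ?thesis
    proof (cases "z = x")
      case True
      then show ?thesis using z y by (simp add: insert_commute)
    next
      case False
      \<comment> \<open>The vertex swapped with \<open>x\<close> is the other end \<open>z\<close>,
        so that the edge at \<open>y\<close> turns into \<open>{x, y}\<close>.\<close>
      then have "transpose x z ` f \<in> E'" using closed y z by blast
      moreover have "transpose x z ` f = {x, y}"
        using z y False by (auto simp: transpose_def)
      ultimately show ?thesis by simp
    qed
  qed
  then have "(\<exists>v\<in>V. \<forall>f\<in>E'. v \<notin> f) \<or> (\<forall>y\<in>V - {x}. {x, y} \<in> E')" by blast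
  with E' show thesis using that by (auto simp: C_def)
qed

section \<open>Induction on the number of vertices\<close>

lemma edges_at_vertex:
  assumes "E \<subseteq> nsets (insert v W) 2" "v \<notin> W"
  shows "{f \<in> E. v \<notin> f} \<subseteq> nsets W 2" "{f \<in> E. v \<in> f} \<subseteq> (\<lambda>w. {v, w}) ` W"
proof -
  show "{f \<in> E. v \<notin> f} \<subseteq> nsets W 2"
    using assms by (auto simp: nsets_def)
  show "{f \<in> E. v \<in> f} \<subseteq> (\<lambda>w. {v, w}) ` W"
    using assms by (fastforce simp: nsets_def card_2_iff doubleton_eq_iff)
qed

lemma dominating_edges:
  assumes "finite W" "v \<notin> W" "E \<subseteq> nsets (insert v W) 2" "(\<lambda>w. {v, w}) ` W \<subseteq> E"
  defines "F \<equiv> {f \<in> E. v \<notin> f}"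
  shows "F \<subseteq> nsets W 2" "card E = card F + card W"
    "matching_poly (insert v W) E = dom_op (matching_poly W F)"
proof -
  show F: "F \<subseteq> nsets W 2" unfolding F_def by (rule edges_at_vertex[OF assms(3,2)])
  have E: "E = F \<union> (\<lambda>w. {v, w}) ` W"
    using edges_at_vertex[OF assms(3,2)] assms(4) unfolding F_def by auto
  have "finite F" using F assms(1) by (rule finite_edges[rotated])
  moreover have "card ((\<lambda>w. {v, w}) ` W) = card W"
    by (intro card_image) (auto simp: inj_on_def doubleton_eq_iff)
  ultimately show "card E = card F + card W"
    using assms(1) by (subst E, subst card_Un_disjoint) (auto simp: F_def)
  show "matching_poly (insert v W) E = dom_op (matching_poly W F)"
    by (subst E) (rule matching_poly_dominating[OF assms(1,2) F])
qed

lemma card_edges_le: "finite V \<Longrightarrow> E \<subseteq> nsets V 2 \<Longrightarrow> card E \<le> card V choose 2"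
  using card_mono[OF finite_imp_finite_nsets] by (metis card_nsets)

text \<open>After reduction, one vertex is split off and the induction hypothesis supplies a lex or
  colex bound for the rest. Adding an isolated vertex to colex, when the edges fit, or a dominating
  vertex to lex is exact; the two mixed cases are \<open>iso_op_lex_poly\<close> and
  \<open>dom_op_colex_poly\<close>.\<close>

lemma lex_or_colex_le_matching_poly:
  assumes "finite V" "E \<subseteq> nsets V 2" "card V = n"
  shows "lex_poly n (card E) \<preceq> matching_poly V E \<or> colex_poly n (card E) \<preceq> matching_poly V E"
  using assms
proof (induction n arbitrary: V E)
  case 0
  then have "V = {}" by simp
  then have "E = {}" using 0 by (auto simp: nsets_def)
  then show ?case using \<open>V = {}\<close> by (simp add: matching_poly_def)
next
  case (Suc n)
  then obtain x where "x \<in> V" by fastforce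
  then obtain E' where E': "E' \<subseteq> nsets V 2" "card E' = card E" "matching_poly V E' \<preceq> matching_poly V E"
    "(\<exists>v\<in>V. \<forall>f\<in>E'. v \<notin> f) \<or> (\<forall>y\<in>V - {x}. {x, y} \<in> E')"
    using reduction_to_dominating_or_isolated Suc.prems by metis
  have "lex_poly (Suc n) (card E') \<preceq> matching_poly V E' \<or> colex_poly (Suc n) (card E') \<preceq> matching_poly V E'"
    using E'(4)
  proof
    assume "\<exists>v\<in>V. \<forall>f\<in>E'. v \<notin> f"
    then obtain v where v: "v \<in> V" "\<And>f. f \<in> E' \<Longrightarrow> v \<notin> f" by blast
    define W where "W = V - {v}"
    have W: "V = insert v W" "v \<notin> W" "finite W" "card W = n"
      using v Suc.prems by (auto simp: W_def)
    have sub: "E' \<subseteq> nsets W 2"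
      using edges_at_vertex(1)[of E' v W] E'(1) W v(2) by blast
    then have le: "card E' \<le> n choose 2" using card_edges_le W by blast
    have "lex_poly n (card E') \<preceq> matching_poly W E' \<or> colex_poly n (card E') \<preceq> matching_poly W E'"
      using Suc.IH W sub by blast
    then show ?thesis
      unfolding W(1) matching_poly_isolated[OF W(3,2) sub]
      using iso_op_mono iso_op_lex_poly[OF le] iso_op_colex_poly[OF le] coeff_le_trans by metis
  next
    assume dom: "\<forall>y\<in>V - {x}. {x, y} \<in> E'"
    define W where "W = V - {x}"
    have W: "V = insert x W" "x \<notin> W" "finite W" "card W = n"
      using \<open>x \<in> V\<close> Suc.prems by (auto simp: W_def)
    define F where "F = {f \<in> E'. x \<notin> f}"
    have star: "(\<lambda>w. {x, w}) ` W \<subseteq> E'" using dom by (auto simp: W_def)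
    have F: "F \<subseteq> nsets W 2" "card E' = card F + n" "matching_poly V E' = dom_op (matching_poly W F)"
      using dominating_edges[OF W(3,2) _ star] E'(1) W by (simp_all add: F_def)
    have le: "card F \<le> n choose 2" using card_edges_le W F by blast
    have "lex_poly n (card F) \<preceq> matching_poly W F \<or> colex_poly n (card F) \<preceq> matching_poly W F"
      using Suc.IH W F by blast
    then show ?thesis
      unfolding F(2,3)
      using dom_op_mono dom_op_colex_poly[OF le] dom_op_lex_poly coeff_le_trans by metis
  qed
  then show ?case using E'(2,3) coeff_le_trans by metis
qed

section \<open>Lex and colex graphs\<close>

lemma lex_less_iff:
  assumes "finite A" "finite B"
  shows "lex_less A B \<longleftrightarrow> (\<exists>a\<in>A - B. \<forall>x<a. x \<in> A \<longleftrightarrow> x \<in> B)"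
proof
  assume L: "lex_less A B"
  let ?D = "sym_diff A B"
  have "finite ?D" "?D \<noteq> {}" using L assms by (auto simp: lex_less_def)
  then have "Min ?D \<in> ?D" by (rule Min_in)
  moreover have "x \<notin> ?D" if "x < Min ?D" for x
    using Min_le[OF \<open>finite ?D\<close>, of x] that by linarith
  ultimately show "\<exists>a\<in>A - B. \<forall>x<a. x \<in> A \<longleftrightarrow> x \<in> B"
    using L unfolding lex_less_def by blast
next
  assume "\<exists>a\<in>A - B. \<forall>x<a. x \<in> A \<longleftrightarrow> x \<in> B"
  then obtain a where a: "a \<in> A - B" "\<forall>x<a. x \<in> A \<longleftrightarrow> x \<in> B" by blast
  then have "Min (sym_diff A B) = a"
    using assms by (intro Min_eqI) (auto simp: not_less[symmetric])
  then show "lex_less A B" using a by (auto simp: lex_less_def)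
qed

lemma colex_less_iff:
  assumes "finite A" "finite B"
  shows "colex_less A B \<longleftrightarrow> (\<exists>b\<in>B - A. \<forall>x>b. x \<in> A \<longleftrightarrow> x \<in> B)"
proof
  assume L: "colex_less A B"
  let ?D = "sym_diff A B"
  have "finite ?D" "?D \<noteq> {}" using L assms by (auto simp: colex_less_def)
  then have "Max ?D \<in> ?D" by (rule Max_in)
  moreover have "x \<notin> ?D" if "x > Max ?D" for x
    using Max_ge[OF \<open>finite ?D\<close>, of x] that by linarith
  ultimately show "\<exists>b\<in>B - A. \<forall>x>b. x \<in> A \<longleftrightarrow> x \<in> B"
    using L unfolding colex_less_def by blast
next
  assume "\<exists>b\<in>B - A. \<forall>x>b. x \<in> A \<longleftrightarrow> x \<in> B"
  then obtain b where b: "b \<in> B - A" "\<forall>x>b. x \<in> A \<longleftrightarrow> x \<in> B" by blast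
  then have "Max (sym_diff A B) = b"
    using assms by (intro Max_eqI) (auto simp: not_less[symmetric])
  then show "colex_less A B" using b by (auto simp: colex_less_def)
qed

section \<open>Initial segments of a strict linear order\<close>

definition strict_linear_on :: "'b set \<Rightarrow> ('b \<Rightarrow> 'b \<Rightarrow> bool) \<Rightarrow> bool" where
  "strict_linear_on S R \<longleftrightarrow> (\<forall>x\<in>S. \<not> R x x) \<and> (\<forall>x\<in>S. \<forall>y\<in>S. x \<noteq> y \<longrightarrow> R x y \<or> R y x)
     \<and> (\<forall>x\<in>S. \<forall>y\<in>S. \<forall>z\<in>S. R x y \<longrightarrow> R y z \<longrightarrow> R x z)"

lemma strict_linear_lex_less:
  assumes "\<And>A. A \<in> S \<Longrightarrow> finite A"
  shows "strict_linear_on S lex_less"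
  unfolding strict_linear_on_def
proof (intro conjI ballI impI)
  fix A B C assume S: "A \<in> S" "B \<in> S" "C \<in> S" and "lex_less A B" "lex_less B C"
  then obtain a b where "a \<in> A - B" "\<forall>x<a. x \<in> A \<longleftrightarrow> x \<in> B" "b \<in> B - C" "\<forall>x<b. x \<in> B \<longleftrightarrow> x \<in> C"
    using assms by (auto simp: lex_less_iff)
  then have "min a b \<in> A - C" "\<forall>x<min a b. x \<in> A \<longleftrightarrow> x \<in> C"
    by (cases a b rule: linorder_cases; auto)+
  then show "lex_less A C" using S assms lex_less_iff by metis
next
  fix A B assume S: "A \<in> S" "B \<in> S" "A \<noteq> B"
  then have "Min (sym_diff A B) \<in> sym_diff A B" using assms by (intro Min_in) auto
  then show "lex_less A B \<or> lex_less B A" using S(3) by (auto simp: lex_less_def Un_commute)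
qed (simp add: lex_less_def)

lemma strict_linear_colex_less:
  assumes "\<And>A. A \<in> S \<Longrightarrow> finite A"
  shows "strict_linear_on S colex_less"
  unfolding strict_linear_on_def
proof (intro conjI ballI impI)
  fix A B C assume S: "A \<in> S" "B \<in> S" "C \<in> S" and "colex_less A B" "colex_less B C"
  then obtain a b where "a \<in> B - A" "\<forall>x>a. x \<in> A \<longleftrightarrow> x \<in> B" "b \<in> C - B" "\<forall>x>b. x \<in> B \<longleftrightarrow> x \<in> C"
    using assms by (auto simp: colex_less_iff)
  then have "max a b \<in> C - A" "\<forall>x>max a b. x \<in> A \<longleftrightarrow> x \<in> C"
    by (cases a b rule: linorder_cases; auto)+
  then show "colex_less A C" using S assms colex_less_iff by metis
next
  fix A B assume S: "A \<in> S" "B \<in> S" "A \<noteq> B"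
  then have "Max (sym_diff A B) \<in> sym_diff A B" using assms by (intro Max_in) auto
  then show "colex_less A B \<or> colex_less B A" using S(3) by (auto simp: colex_less_def Un_commute)
qed (simp add: colex_less_def)

text \<open>The number of predecessors is a bijection from \<open>S\<close> onto
  \<open>{..<card S}\<close>, and the first \<open>k\<close> elements are those of rank below
  \<open>k\<close>.\<close>

lemma first_elems:
  assumes "finite S" "strict_linear_on S R"
  shows first_elems_closed: "x \<in> first_elems R S k \<Longrightarrow> y \<in> S \<Longrightarrow> R y x \<Longrightarrow> y \<in> first_elems R S k"
    and card_first_elems: "k \<le> card S \<Longrightarrow> card (first_elems R S k) = k"
proof -
  define r where "r x = card {y \<in> S. R y x}" for x
  have irrefl: "\<not> R x x" if "x \<in> S" for x
    using assms(2) that by (simp add: strict_linear_on_def)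
  have trans: "R x z" if "x \<in> S" "y \<in> S" "z \<in> S" "R x y" "R y z" for x y z
    using assms(2) that unfolding strict_linear_on_def by blast
  have r_less: "r x < r y" if "x \<in> S" "y \<in> S" "R x y" for x y
  proof -
    have "{z \<in> S. R z x} \<subset> {z \<in> S. R z y}"
      using trans[OF _ that(1,2) _ that(3)] irrefl[OF that(1)] that by blast
    then show ?thesis
      unfolding r_def using assms(1) by (intro psubset_card_mono) auto
  qed
  then show "x \<in> first_elems R S k \<Longrightarrow> y \<in> S \<Longrightarrow> R y x \<Longrightarrow> y \<in> first_elems R S k"
    unfolding first_elems_def r_def[symmetric] by fastforce
  have inj: "inj_on r S"
    using r_less assms(2) unfolding inj_on_def strict_linear_on_def by (metis less_irrefl)
  have "r x < card S" if "x \<in> S" for x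
    unfolding r_def using assms(1) irrefl that by (intro psubset_card_mono) auto
  then have "r ` S = {..<card S}"
    using inj assms(1) by (intro card_subset_eq) (auto simp: card_image)
  moreover have "r ` first_elems R S k = r ` S \<inter> {..<k}"
    unfolding first_elems_def r_def[symmetric] by auto
  ultimately have "k \<le> card S \<Longrightarrow> r ` first_elems R S k = {..<k}" by auto
  moreover have "card (first_elems R S k) = card (r ` first_elems R S k)"
    using inj by (intro card_image[symmetric] inj_on_subset[OF inj]) (auto simp: first_elems_def)
  ultimately show "k \<le> card S \<Longrightarrow> card (first_elems R S k) = k" by simp
qed

text \<open>Stated for an arbitrary finite vertex set and initial segment, so that deleting the
  least vertex stays within the statement.\<close>

lemma matching_poly_lex_initial:
  assumes "finite S" "F \<subseteq> nsets S 2" "card S = n"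
    and "\<And>f g. f \<in> F \<Longrightarrow> g \<in> nsets S 2 \<Longrightarrow> lex_less g f \<Longrightarrow> g \<in> F"
  shows "matching_poly S F = lex_poly n (card F)"
  using assms
proof (induction n arbitrary: S F)
  case 0
  then have "S = {}" by simp
  then have "F = {}" using 0 by (auto simp: nsets_def)
  then show ?case using \<open>S = {}\<close> by (simp add: matching_poly_def)
next
  case (Suc n)
  define v where "v = Min S"
  define W where "W = S - {v}"
  have "v \<in> S" unfolding v_def using Suc.prems by (intro Min_in) auto
  have W: "S = insert v W" "v \<notin> W" "finite W" "card W = n"
    using \<open>v \<in> S\<close> Suc.prems by (auto simp: W_def)
  have v_less: "v < w" if "w \<in> W" for w
    using that Suc.prems(1) by (auto simp: W_def v_def order_less_le)
  show ?case
  proof (cases "(\<lambda>w. {v, w}) ` W \<subseteq> F")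
    case True
    define G where "G = {f \<in> F. v \<notin> f}"
    have G: "G \<subseteq> nsets W 2" "card F = card G + n" "matching_poly S F = dom_op (matching_poly W G)"
      using dominating_edges[OF W(3,2) _ True] Suc.prems(2) W by (simp_all add: G_def)
    have "matching_poly W G = lex_poly n (card G)"
    proof (rule Suc.IH[OF W(3) G(1) W(4)])
      fix f g assume "f \<in> G" "g \<in> nsets W 2" "lex_less g f"
      then show "g \<in> G" using Suc.prems(4)[of f g] W by (auto simp: G_def nsets_def)
    qed
    then show ?thesis unfolding G(2,3) by (simp add: dom_op_lex_poly del: lex_poly.simps)
  next
    case False
    then obtain w where w: "w \<in> W" "{v, w} \<notin> F" by blast
    \<comment> \<open>An edge avoiding the least vertex comes after every edge
      \<open>{v, w}\<close>, so one missing edge at \<open>v\<close> leaves only a star.\<close>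
    have all_v: "v \<in> f" if "f \<in> F" for f
    proof (rule ccontr)
      assume "v \<notin> f"
      then have "f \<subseteq> W" "finite f" using that Suc.prems(2) W by (auto simp: nsets_def)
      have "x \<notin> f" "x \<notin> {v, w}" if "x < v" for x
        using v_less[of x] v_less[OF w(1)] \<open>f \<subseteq> W\<close> that by auto
      then have "lex_less {v, w} f"
        using \<open>finite f\<close> \<open>v \<notin> f\<close> lex_less_iff[of "{v, w}" f] by blast
      moreover have "v \<noteq> w" using w(1) W(2) by blast
      then have "{v, w} \<in> nsets S 2" using w(1) W(1) by (auto simp: nsets_def)
      ultimately show False using Suc.prems(4) that w by blast
    qed
    then have "F \<subset> (\<lambda>w. {v, w}) ` W"
      using edges_at_vertex(2)[of F v W] W Suc.prems(2) w by blast
    then have "card F < n"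
      using psubset_card_mono[of "(\<lambda>w. {v, w}) ` W" F] card_image_le[of W "\<lambda>w. {v, w}"] W by simp
    moreover have "matching_poly S F = monom 1 (card S) + of_nat (card F) * monom 1 (card S - 2)"
      using finite_edges[OF Suc.prems(1,2)] all_v by (rule matching_poly_star)
    ultimately show ?thesis using Suc.prems(3) by simp
  qed
qed

text \<open>The greatest vertex decides the branch: without edges it is isolated, and otherwise all
  edges below it are present. In the latter case the least vertex is dominating and is the one
  deleted.\<close>

lemma matching_poly_colex_initial:
  assumes "finite S" "F \<subseteq> nsets S 2" "card S = n"
    and "\<And>f g. f \<in> F \<Longrightarrow> g \<in> nsets S 2 \<Longrightarrow> colex_less g f \<Longrightarrow> g \<in> F"
  shows "matching_poly S F = colex_poly n (card F)"
  using assms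
proof (induction n arbitrary: S F)
  case 0
  then have "S = {}" by simp
  then have "F = {}" using 0 by (auto simp: nsets_def)
  then show ?case using \<open>S = {}\<close> by (simp add: matching_poly_def)
next
  case (Suc n)
  define v where "v = Max S"
  define W where "W = S - {v}"
  have "v \<in> S" unfolding v_def using Suc.prems by (intro Max_in) auto
  have W: "S = insert v W" "v \<notin> W" "finite W" "card W = n"
    using \<open>v \<in> S\<close> Suc.prems by (auto simp: W_def)
  have v_greater: "w < v" if "w \<in> W" for w
    using that Suc.prems(1) by (auto simp: W_def v_def order_less_le)
  show ?case
  proof (cases "\<exists>f\<in>F. v \<in> f")
    case False
    then have F: "F \<subseteq> nsets W 2"
      using edges_at_vertex(1)[of F v W] Suc.prems(2) W by blast
    have "matching_poly W F = colex_poly n (card F)"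
    proof (rule Suc.IH[OF W(3) F W(4)])
      fix f g assume "f \<in> F" "g \<in> nsets W 2" "colex_less g f"
      then show "g \<in> F" using Suc.prems(4)[of f g] W by (auto simp: nsets_def)
    qed
    moreover have "card F \<le> n choose 2" using card_edges_le[OF W(3) F] W by simp
    moreover have "matching_poly S F = iso_op (matching_poly W F)"
      unfolding W(1) using W(3,2) F by (rule matching_poly_isolated)
    ultimately show ?thesis by simp
  next
    case True
    then obtain f where f: "f \<in> F" "v \<in> f" by blast
    then obtain z where z: "f = {v, z}" "z \<in> W"
      using edges_at_vertex(2)[of F v W] Suc.prems(2) W by blast
    have "g \<in> F" if g: "g \<in> nsets W 2" for g
    proof -
      have "g \<subseteq> W" "finite g" using g by (auto simp: nsets_def)
      have "x \<notin> g" "x \<notin> f" if "x > v" for x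
        using v_greater[of x] v_greater[OF z(2)] z(1) \<open>g \<subseteq> W\<close> that by auto
      moreover have "v \<in> f - g" "finite f" using f z \<open>g \<subseteq> W\<close> W(2) by auto
      ultimately have "colex_less g f"
        using \<open>finite g\<close> colex_less_iff[of g f] by blast
      moreover have "g \<in> nsets S 2" using g W by (auto simp: nsets_def)
      ultimately show ?thesis using Suc.prems(4) f by blast
    qed
    then have all_W: "nsets W 2 \<subseteq> F" by blast
    then have "nsets W 2 \<subset> F" using f W(2) by (auto simp: nsets_def)
    then have "card (nsets W 2) < card F"
      using finite_edges[OF Suc.prems(1,2)] by (rule psubset_card_mono[rotated])
    then have gt: "n choose 2 < card F" using W by (simp add: card_nsets)
    define u where "u = Min S"
    define U where "U = S - {u}"
    have "u \<in> S" unfolding u_def using Suc.prems by (intro Min_in) auto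
    have U: "S = insert u U" "u \<notin> U" "finite U" "card U = n"
      using \<open>u \<in> S\<close> Suc.prems by (auto simp: U_def)
    have "u \<le> z" using z W Suc.prems(1) by (auto simp: u_def)
    then have "u < v" using v_greater z by fastforce
    then have "u \<in> W" using \<open>u \<in> S\<close> by (auto simp: W_def)
    have star: "(\<lambda>w. {u, w}) ` U \<subseteq> F"
    proof clarify
      fix w assume w: "w \<in> U"
      show "{u, w} \<in> F"
      proof (cases "w = v")
        case False
        moreover have "u \<noteq> w" using w U(2) by blast
        ultimately have "{u, w} \<in> nsets W 2"
          using w \<open>u \<in> W\<close> by (auto simp: nsets_def U_def W_def)
        then show ?thesis using all_W by blast
      next
        case True
        \<comment> \<open>Among the edges at \<open>v\<close>, the one to the least vertex comes
          first in colex order, so it is present as soon as any of them is.\<close>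
        have "{u, v} \<in> F"
        proof (cases "u = z")
          case True
          then show ?thesis using f z by (simp add: insert_commute)
        next
          case False
          then have "u < z" using \<open>u \<le> z\<close> by simp
          then have "z \<in> f - {u, v}" "\<forall>x>z. x \<in> {u, v} \<longleftrightarrow> x \<in> f"
            using z W(2) by auto
          then have "colex_less {u, v} f"
            using z(1) colex_less_iff[of "{u, v}" f] by blast
          moreover have "{u, v} \<in> nsets S 2" using \<open>u < v\<close> \<open>u \<in> S\<close> \<open>v \<in> S\<close> by (auto simp: nsets_def)
          ultimately show ?thesis using Suc.prems(4) f by blast
        qed
        then show ?thesis using True by simp
      qed
    qed
    define G where "G = {g \<in> F. u \<notin> g}"
    have G: "G \<subseteq> nsets U 2" "card F = card G + n" "matching_poly S F = dom_op (matching_poly U G)"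
      using dominating_edges[OF U(3,2) _ star] Suc.prems(2) U by (simp_all add: G_def)
    have "matching_poly U G = colex_poly n (card G)"
    proof (rule Suc.IH[OF U(3) G(1) U(4)])
      fix f g assume "f \<in> G" "g \<in> nsets U 2" "colex_less g f"
      then show "g \<in> G" using Suc.prems(4)[of f g] U by (auto simp: G_def nsets_def)
    qed
    then show ?thesis using gt G by simp
  qed
qed

lemma lex_graph_edges:
  assumes "e \<le> n choose 2"
  shows "edges (lex_graph n e) \<subseteq> nsets {1..n} 2"
    "matching_poly {1..n} (edges (lex_graph n e)) = lex_poly n e"
proof -
  let ?S = "nsets {1..n} 2"
  have lin: "strict_linear_on ?S lex_less" by (rule strict_linear_lex_less) (auto simp: nsets_def)
  have fin: "finite ?S" by (simp add: finite_imp_finite_nsets)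
  show sub: "edges (lex_graph n e) \<subseteq> ?S" by (auto simp: lex_graph_def first_elems_def)
  have "card (edges (lex_graph n e)) = e"
    using card_first_elems[OF fin lin] assms by (simp add: lex_graph_def card_nsets)
  moreover have "matching_poly {1..n} (edges (lex_graph n e)) = lex_poly n (card (edges (lex_graph n e)))"
    using sub first_elems_closed[OF fin lin]
    by (intro matching_poly_lex_initial) (auto simp: lex_graph_def)
  ultimately show "matching_poly {1..n} (edges (lex_graph n e)) = lex_poly n e" by simp
qed

lemma colex_graph_edges:
  assumes "e \<le> n choose 2"
  shows "edges (colex_graph n e) \<subseteq> nsets {1..n} 2"
    "matching_poly {1..n} (edges (colex_graph n e)) = colex_poly n e"
proof -
  let ?S = "nsets {1..n} 2"
  have lin: "strict_linear_on ?S colex_less" by (rule strict_linear_colex_less) (auto simp: nsets_def)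
  have fin: "finite ?S" by (simp add: finite_imp_finite_nsets)
  show sub: "edges (colex_graph n e) \<subseteq> ?S" by (auto simp: colex_graph_def first_elems_def)
  have "card (edges (colex_graph n e)) = e"
    using card_first_elems[OF fin lin] assms by (simp add: colex_graph_def card_nsets)
  moreover have "matching_poly {1..n} (edges (colex_graph n e)) = colex_poly n (card (edges (colex_graph n e)))"
    using sub first_elems_closed[OF fin lin]
    by (intro matching_poly_colex_initial) (auto simp: colex_graph_def)
  ultimately show "matching_poly {1..n} (edges (colex_graph n e)) = colex_poly n e" by simp
qed

text \<open>The total count is the value of the polynomial at 1 and the count for size
  \<open>k\<close> is one coefficient. If \<open>2 * k\<close> exceeds the number of vertices, the
  left count is zero.\<close>

lemma num_matchings_mono:
  assumes "finite V" "E \<subseteq> nsets V 2" "finite W" "F \<subseteq> nsets W 2" "card V = card W"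
    and "matching_poly V E \<preceq> matching_poly W F"
  shows "num_matchings (V, E) \<le> num_matchings (W, F)"
    "num_matchings_of_size k (V, E) \<le> num_matchings_of_size k (W, F)"
proof -
  have set_eq: "{M. matching (U, D) M} = matchings D"
    "{M. matching (U, D) M \<and> card M = k} = {M \<in> matchings D. card M = k}"
    for U :: "'c set" and D
    by (auto simp: matching_def matchings_def)
  have fin: "finite E" "finite F" using assms finite_edges by blast+
  show "num_matchings (V, E) \<le> num_matchings (W, F)"
    using poly_1_mono[OF assms(6)] fin
    by (simp add: num_matchings_def set_eq poly_matching_poly_1)
  show "num_matchings_of_size k (V, E) \<le> num_matchings_of_size k (W, F)"
  proof (cases "2 * k \<le> card V")
    case True
    have "coeff (matching_poly V E) (card V - 2 * k) \<le> coeff (matching_poly W F) (card W - 2 * k)"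
      using assms(5,6) by (simp add: coeff_le_def)
    then show ?thesis
      using coeff_matching_poly[OF assms(1,2) True] coeff_matching_poly[OF assms(3,4)] True assms(5)
      by (simp add: num_matchings_of_size_def set_eq)
  next
    case False
    then have none: "{M \<in> matchings E. card M = k} = {}"
      using card_matching_le[OF assms(1,2)] by blast
    show ?thesis unfolding num_matchings_of_size_def set_eq none by simp
  qed
qed

theorem theorem1p2:
  fixes G :: "'a graph" and n e k :: nat
  assumes "n \<ge> 1"
    and "e \<le> n choose 2"
    and "simple_graph G"
    and "card (verts G) = n"
    and "card (edges G) = e"
  shows "num_matchings G
           \<ge> min (num_matchings (lex_graph n e)) (num_matchings (colex_graph n e))
       \<and> num_matchings_of_size k G
           \<ge> min (num_matchings_of_size k (lex_graph n e)) (num_matchings_of_size k (colex_graph n e))"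
proof -
  obtain V E where G: "G = (V, E)" by (cases G)
  have V: "finite V" "E \<subseteq> nsets V 2" "card V = n" "card E = e"
    using assms(3-5) by (auto simp: G simple_graph_def)
  obtain F F' where F: "lex_graph n e = ({1..n}, F)" "colex_graph n e = ({1..n}, F')"
    by (simp add: lex_graph_def colex_graph_def)
  note lex = lex_graph_edges[OF assms(2), unfolded F snd_conv]
  note colex = colex_graph_edges[OF assms(2), unfolded F snd_conv]
  have card: "card {1..n} = card V" using V by simp
  have "lex_poly n e \<preceq> matching_poly V E \<or> colex_poly n e \<preceq> matching_poly V E"
    using lex_or_colex_le_matching_poly[OF V(1-3)] V(4) by simp
  then show ?thesis
  proof
    assume "lex_poly n e \<preceq> matching_poly V E"
    then show ?thesis
      using num_matchings_mono[OF _ lex(1) V(1,2) card] lex(2) by (simp add: G F min.coboundedI1)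
  next
    assume "colex_poly n e \<preceq> matching_poly V E"
    then show ?thesis
      using num_matchings_mono[OF _ colex(1) V(1,2) card] colex(2) by (simp add: G F min.coboundedI2)
  qed
qed


end
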